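(* Let $n \geq 1$, let $G$ be a connected multigraph with vertex set $V(G) = \{0,1,\ldots,n\}$ and root $0$, and let $\prec$ be any total order on the set $\widetilde{V}(G) = \{1,\ldots,n\}$ of non-root vertices. Then, as an identity of polynomials in the indeterminate $q$, \[ \sum_{\alpha \in \mathrm{PF}(G)} q^{\mathrm{rsum}(\alpha)} = \sum_{T \in \mathrm{SPT}(G)}q^{\kappa(G,T,\prec)} \cdot \left(\prod_{e \in E(T)} [\omega_{G}(e)]_q\right).\]
   Context: $\mathbb{N} = \{0,1,2,\ldots\}$ and $[k]_q := 1+q+\cdots+q^{k-1}$ for $k \in \mathbb{N}$. A multigraph $G$ is a finite vertex set $V(G)$ together with an edge-weight (multiplicity) function $\omega_G \colon \binom{V(G)}{2} \to \mathbb{N}$ (multiple edges allowed, no loops, undirected); $\#E(G) := \sum_{e} \omega_G(e)$ counts edges with multiplicity. $G$ is connected in the usual sense (using edges of positive weight). A $G$-parking function is a sequence $\alpha = (\alpha_1,\ldots,\alpha_n) \in \mathbb{N}^n$ such that for every nonempty $U \subseteq \widetilde{V}(G)$ there is $i \in U$ with $\alpha_i \leq \left(\sum_{j \in V(G)-U} \omega_G(\{i,j\})\right) - 1$. The set of these is $\mathrm{PF}(G)$. The reversed sum of $\alpha \in \mathrm{PF}(G)$ is $\mathrm{rsum}(\alpha) := \#E(G) - n - \sum_{i=1}^n \alpha_i$. $\mathrm{SPT}(G)$ is the set of spanning trees of $G$: trees $T$ with $V(T) = V(G)$ all of whose edges $e$ satisfy $\omega_G(e) \geq 1$ (parallel copies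 of an edge are not distinguished, so $T$ is determined by its set of vertex pairs $E(T)$). Such $T$ is rooted at $0$; $\leq_T$ is the partial order on $V(T)$ where $i \leq_T j$ iff the unique path in $T$ from $j$ to $0$ passes through $i$, and $\mathrm{par}_T(i)$ is the parent of a non-root vertex $i$. For $T \in \mathrm{SPT}(G)$ and a total order $\prec$ on $\widetilde{V}(G)$, \[ \kappa(G,T,\prec) := \sum_{\substack{i,j \in \widetilde{V}(G), \\ i \leq_T j, \; j \prec i }} \omega_{G}(\{\mathrm{par}_T(i),j\}). \] *)

theory Defs
  imports
    "HOL-Library.FuncSet"
    "HOL-Library.Ramsey"
    "HOL-Computational_Algebra.Polynomial"
begin

text \<open>A multigraph on the vertices \<open>{0..n}\<close> is given by its multiplicity function
  \<open>w :: nat set \<Rightarrow> nat\<close>; only its values on the two-element subsets of \<open>{0..n}\<close>,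
  i.e. on \<open>nsets {0..n} 2\<close>, are meaningful. The root is \<open>0\<close>.\<close>

definition simple_path :: "'a set set \<Rightarrow> 'a \<Rightarrow> 'a \<Rightarrow> 'a list \<Rightarrow> bool" where
  "simple_path E x y p \<longleftrightarrow>
     p \<noteq> [] \<and> hd p = x \<and> last p = y \<and> distinct p \<and> successively (\<lambda>u v. {u, v} \<in> E) p"

definition graph_connected :: "'a set \<Rightarrow> 'a set set \<Rightarrow> bool" where
  "graph_connected V E \<longleftrightarrow> (\<forall>x\<in>V. \<forall>y\<in>V. \<exists>p. simple_path E x y p)"

definition graph_cycle :: "'a set set \<Rightarrow> 'a list \<Rightarrow> bool" where
  "graph_cycle E c \<longleftrightarrow>
     3 \<le> length c \<and> distinct c \<and> successively (\<lambda>u v. {u, v} \<in> E) c \<and> {last c, hd c} \<in> E"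

definition is_tree :: "'a set \<Rightarrow> 'a set set \<Rightarrow> bool" where
  "is_tree V E \<longleftrightarrow> E \<subseteq> nsets V 2 \<and> graph_connected V E \<and> \<not> (\<exists>c. graph_cycle E c)"

definition multigraph_connected :: "nat \<Rightarrow> (nat set \<Rightarrow> nat) \<Rightarrow> bool" where
  "multigraph_connected n w \<longleftrightarrow> graph_connected {0..n} {e \<in> nsets {0..n} 2. w e > 0}"

definition num_edges :: "nat \<Rightarrow> (nat set \<Rightarrow> nat) \<Rightarrow> nat" where
  "num_edges n w = (\<Sum>e\<in>nsets {0..n} 2. w e)"

text \<open>A sequence \<open>(\<alpha>\<^sub>1, \<dots>, \<alpha>\<^sub>n)\<close> is an extensional function on \<open>{1..n}\<close>, so that distinct
  members of \<open>PF n w\<close> are distinct sequences.\<close>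

definition PF :: "nat \<Rightarrow> (nat set \<Rightarrow> nat) \<Rightarrow> (nat \<Rightarrow> nat) set" where
  "PF n w = {\<alpha> \<in> {1..n} \<rightarrow>\<^sub>E UNIV. \<forall>U. U \<subseteq> {1..n} \<and> U \<noteq> {} \<longrightarrow>
     (\<exists>i\<in>U. int (\<alpha> i) \<le> int (\<Sum>j\<in>{0..n} - U. w {i, j}) - 1)}"

definition rsum :: "nat \<Rightarrow> (nat set \<Rightarrow> nat) \<Rightarrow> (nat \<Rightarrow> nat) \<Rightarrow> int" where
  "rsum n w \<alpha> = int (num_edges n w) - int n - (\<Sum>i=1..n. int (\<alpha> i))"

definition SPT :: "nat \<Rightarrow> (nat set \<Rightarrow> nat) \<Rightarrow> nat set set set" where
  "SPT n w = {T. is_tree {0..n} T \<and> (\<forall>e\<in>T. w e \<ge> 1)}"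

definition root_path :: "nat set set \<Rightarrow> nat \<Rightarrow> nat list" where
  "root_path T j = (THE p. simple_path T j 0 p)"

definition tree_le :: "nat set set \<Rightarrow> nat \<Rightarrow> nat \<Rightarrow> bool" where
  "tree_le T i j \<longleftrightarrow> i \<in> set (root_path T j)"

definition par :: "nat set set \<Rightarrow> nat \<Rightarrow> nat" where
  "par T i = root_path T i ! 1"

text \<open>The relation \<open>r\<close> is the strict order: \<open>(j, i) \<in> r\<close> means \<open>j \<prec> i\<close>.\<close>

definition kappa :: "nat \<Rightarrow> (nat set \<Rightarrow> nat) \<Rightarrow> nat set set \<Rightarrow> (nat \<times> nat) set \<Rightarrow> nat" where
  "kappa n w T r =
     (\<Sum>(i, j) \<in> {(i, j). i \<in> {1..n} \<and> j \<in> {1..n} \<and> tree_le T i j \<and> (j, i) \<in> r}. w {par T i, j})"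

abbreviation q_var :: "int poly" where
  "q_var \<equiv> [:0, 1:]"

definition q_int :: "nat \<Rightarrow> int poly" where
  "q_int k = (\<Sum>i<k. q_var ^ i)"

lemma sum_le_edges_aux:
  assumes "finite U" "U \<subseteq> {1..n}" "\<alpha> \<in> PF n w"
  shows "(\<Sum>i\<in>U. int (\<alpha> i)) + int (card U) + int (\<Sum>e\<in>nsets ({0..n} - U) 2. w e) \<le> int (num_edges n w)"
  using assms
proof (induction U rule: finite_psubset_induct)
  case (psubset U)
  show ?case
  proof (cases "U = {}")
    case True
    then show ?thesis by (simp add: num_edges_def)
  next
    case False
    obtain i where i: "i \<in> U" "int (\<alpha> i) \<le> int (\<Sum>j\<in>{0..n} - U. w {i, j}) - 1"
      using psubset.prems False unfolding PF_def by blast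
    let ?W = "{0..n} - U"
    have W: "{0..n} - (U - {i}) = insert i ?W" using i psubset.prems by auto
    have IH: "(\<Sum>k\<in>U - {i}. int (\<alpha> k)) + int (card (U - {i}))
        + int (\<Sum>e\<in>nsets (insert i ?W) 2. w e) \<le> int (num_edges n w)"
      using psubset.IH[of "U - {i}"] i psubset.prems W by auto
    have split: "nsets (insert i ?W) 2 = nsets ?W 2 \<union> (\<lambda>j. {i, j}) ` ?W"
      using i by (auto simp: nsets_def card_2_iff doubleton_eq_iff)
    have "(\<Sum>e\<in>nsets (insert i ?W) 2. w e)
        = (\<Sum>e\<in>nsets ?W 2. w e) + (\<Sum>e\<in>(\<lambda>j. {i, j}) ` ?W. w e)"
      unfolding split using i by (intro sum.union_disjoint) (auto simp: nsets_def finite_imp_finite_nsets)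
    also have "(\<Sum>e\<in>(\<lambda>j. {i, j}) ` ?W. w e) = (\<Sum>j\<in>?W. w {i, j})"
      by (subst sum.reindex) (auto simp: inj_on_def doubleton_eq_iff)
    finally have S: "(\<Sum>e\<in>nsets (insert i ?W) 2. w e) = (\<Sum>e\<in>nsets ?W 2. w e) + (\<Sum>j\<in>?W. w {i, j})" .
    have "(\<Sum>k\<in>U. int (\<alpha> k)) = int (\<alpha> i) + (\<Sum>k\<in>U - {i}. int (\<alpha> k))"
      using i psubset.hyps by (simp add: sum.remove)
    moreover have "card U = Suc (card (U - {i}))"
      using i psubset.hyps by (metis card_Suc_Diff1)
    ultimately show ?thesis using IH i(2) S by linarith
  qed
qed

text \<open>On parking functions \<open>rsum\<close> is non-negative, so \<open>q_var ^ nat (rsum n w \<alpha>)\<close> does not truncate.\<close>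

lemma rsum_nonneg:
  assumes "\<alpha> \<in> PF n w"
  shows "rsum n w \<alpha> \<ge> 0"
proof -
  have "nsets ({0..n} - {1..n}) 2 = {}"
    by (auto simp: nsets_def card_2_iff)
  then show ?thesis
    using sum_le_edges_aux[of "{1..n}" n \<alpha> w] assms by (simp add: rsum_def)
qed

lemma finite_PF: "finite (PF n w)"
proof (rule finite_subset)
  show "PF n w \<subseteq> (\<Pi>\<^sub>E i\<in>{1..n}. {..\<Sum>j\<in>{0..n} - {i}. w {i, j}})"
  proof
    fix \<alpha> assume a: "\<alpha> \<in> PF n w"
    have "\<alpha> i \<le> (\<Sum>j\<in>{0..n} - {i}. w {i, j})" if "i \<in> {1..n}" for i
    proof -
      have "\<exists>k\<in>{i}. int (\<alpha> k) \<le> int (\<Sum>j\<in>{0..n} - {i}. w {k, j}) - 1"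
        using a that unfolding PF_def by blast
      then have "int (\<alpha> i) \<le> int (\<Sum>j\<in>{0..n} - {i}. w {i, j}) - 1"
        by blast
      then show ?thesis by linarith
    qed
    then show "\<alpha> \<in> (\<Pi>\<^sub>E i\<in>{1..n}. {..\<Sum>j\<in>{0..n} - {i}. w {i, j}})"
      using a by (auto simp: PF_def PiE_iff)
  qed
qed (auto intro: finite_PiE)

lemma finite_SPT: "finite (SPT n w)"
  by (rule finite_subset[of _ "Pow (nsets {0..n} 2)"])
    (auto simp: SPT_def is_tree_def finite_imp_finite_nsets)

end

theory Submission
  imports Defs
begin

text \<open>The identity holds because both sides satisfy the same recursion, which follows a depth-first
  version of Dhar's burning algorithm. The state of the algorithm consists of the set \<open>S\<close> of unburnt
  vertices, a tree on the burnt vertices, a current burnt vertex \<open>u\<close>, and the number \<open>W v j\<close> of edges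
  from each burnt \<open>v\<close> to each unburnt \<open>j\<close> that have not been discarded yet. Let \<open>i\<close> be the
  \<open>\<prec>\<close>-largest unburnt vertex with \<open>m = W u i > 0\<close>.

  A parking function has either \<open>\<alpha> i \<ge> m\<close> or \<open>\<alpha> i < m\<close>. In the first case the edges between \<open>u\<close> and
  \<open>i\<close> can be discarded, lowering \<open>\<alpha> i\<close> by \<open>m\<close>. In the second case \<open>i\<close> burns from \<open>u\<close>; the \<open>m\<close>
  possible values of \<open>\<alpha> i\<close> contribute \<open>q\<^sup>c [m]\<^sub>q\<close>, where \<open>c\<close> counts the remaining edges from \<open>i\<close> to
  burnt vertices other than \<open>u\<close> (lemma \<open>parking_enum_step\<close>).

  A spanning tree extending the burnt tree either avoids the edge \<open>{u, i}\<close> or makes \<open>u\<close> the parent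
  of \<open>i\<close>. In the first case the edges between \<open>u\<close> and \<open>i\<close> contribute nothing to \<open>\<kappa>\<close>: they would
  contribute only if \<open>i\<close> lay below some child \<open>x\<close> of \<open>u\<close> with \<open>i \<prec> x\<close>, and \<open>i\<close> was chosen largest.
  So they can be discarded. In the second case they contribute \<open>[m]\<^sub>q\<close>, while the part of \<open>\<kappa>\<close> that
  comes from \<open>i\<close> is exactly \<open>c\<close>, because every remaining edge from \<open>i\<close> to a burnt vertex other than
  \<open>u\<close> is an inversion edge (lemma \<open>tree_enum_step\<close>). This last fact is an invariant of the search:
  all burnt vertices with remaining edges are ancestors of \<open>u\<close>, and an edge from such a vertex \<open>v\<close> to
  an unburnt \<open>j\<close> has been discarded unless \<open>j\<close> precedes the child of \<open>v\<close> that leads to \<open>u\<close>.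

  When \<open>u\<close> has no remaining edges, the search backtracks to the parent of \<open>u\<close>. When the root has none
  left, both sides are \<open>1\<close> if \<open>S\<close> is empty and \<open>0\<close> otherwise. Starting with the root as the only burnt
  vertex gives the theorem, once rooted spanning trees are encoded by their parent maps.\<close>

section \<open>Parent maps\<close>

text \<open>Sending the root, and everything that is not a vertex, to \<open>0\<close> makes these maps total, so that the
  ancestors of a vertex are just its iterated images.\<close>

definition parent_maps :: "nat \<Rightarrow> (nat \<Rightarrow> nat) set" where
  "parent_maps n = {p. (\<forall>x. p x \<le> n) \<and> (\<forall>x. x \<notin> {1..n} \<longrightarrow> p x = 0) \<and> (\<forall>x. \<exists>k. (p ^^ k) x = 0)}"

definition ancestor :: "('a \<Rightarrow> 'a) \<Rightarrow> 'a \<Rightarrow> 'a \<Rightarrow> bool" where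
  "ancestor p x y \<longleftrightarrow> (\<exists>k. (p ^^ k) y = x)"

lemma ancestor_refl [simp]: "ancestor p x x"
  unfolding ancestor_def by (rule exI[of _ 0]) simp

lemma ancestor_parent: "ancestor p (p x) x"
  unfolding ancestor_def by (rule exI[of _ 1]) simp

lemma ancestor_trans: "ancestor p x y \<Longrightarrow> ancestor p y z \<Longrightarrow> ancestor p x z"
  unfolding ancestor_def by (metis comp_apply funpow_add)

lemma ancestor_unfold: "ancestor p x y \<longleftrightarrow> x = y \<or> ancestor p x (p y)"
proof
  assume "ancestor p x y"
  then obtain k where k: "(p ^^ k) y = x" by (auto simp: ancestor_def)
  show "x = y \<or> ancestor p x (p y)"
  proof (cases k)
    case (Suc m)
    then have "(p ^^ m) (p y) = x" using k by (simp add: funpow_swap1)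
    then show ?thesis by (auto simp: ancestor_def)
  qed (use k in auto)
qed (use ancestor_trans[OF _ ancestor_parent] in auto)

lemma parent_maps_root: "p \<in> parent_maps n \<Longrightarrow> p 0 = 0"
  by (simp add: parent_maps_def)

lemma funpow_root: "p \<in> parent_maps n \<Longrightarrow> (p ^^ k) 0 = 0"
  by (induction k) (auto simp: parent_maps_root)

lemma ancestor_root: "p \<in> parent_maps n \<Longrightarrow> ancestor p x 0 \<Longrightarrow> x = 0"
  by (auto simp: ancestor_def funpow_root)

lemma root_ancestor: "p \<in> parent_maps n \<Longrightarrow> ancestor p 0 x"
  by (auto simp: parent_maps_def ancestor_def)

lemma parent_induct [consumes 1, case_names root step]:
  assumes "p \<in> parent_maps n"
    and "P 0" and "\<And>x. x \<noteq> 0 \<Longrightarrow> P (p x) \<Longrightarrow> P x"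
  shows "P x"
proof -
  obtain k where "(p ^^ k) x = 0" using assms(1) unfolding parent_maps_def by blast
  then show ?thesis
  proof (induction k arbitrary: x)
    case 0
    then show ?case using assms(2) by simp
  next
    case (Suc k)
    then have "P (p x)" by (simp add: funpow_swap1)
    then show ?case using assms(2,3) by (cases "x = 0") auto
  qed
qed

text \<open>A vertex on a cycle of \<open>p\<close> would never reach the root; the proof pushes a fixed point of an iterate
  of \<open>p\<close> along the parent chain to the root.\<close>

lemma parent_not_descendant:
  assumes "p \<in> parent_maps n" "x \<noteq> 0"
  shows "\<not> ancestor p x (p x)"
proof
  assume "ancestor p x (p x)"
  then obtain k where "(p ^^ k) (p x) = x" by (auto simp: ancestor_def)
  then have k: "(p ^^ Suc k) x = x" by (simp add: funpow_swap1)
  have "y \<noteq> 0 \<and> (p ^^ Suc k) y = y \<Longrightarrow> False" for y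
  proof (induction y rule: parent_induct[OF assms(1)])
    case (2 y)
    have "(p ^^ Suc k) (p y) = p ((p ^^ Suc k) y)" by (rule funpow_swap1[symmetric])
    then have fix_p: "(p ^^ Suc k) (p y) = p y" using 2(3) by (simp only:)
    have "p y \<noteq> 0"
    proof
      assume "p y = 0"
      then have "(p ^^ Suc k) y = 0" using funpow_root[OF assms(1), of k] by (simp add: funpow_swap1)
      then show False using 2 by simp
    qed
    then show ?case using 2 fix_p by blast
  qed simp
  then show False using k assms(2) by blast
qed

lemma ancestor_antisym:
  assumes "p \<in> parent_maps n" "ancestor p x y" "ancestor p y x"
  shows "x = y"
proof (rule ccontr)
  assume "x \<noteq> y"
  then have "ancestor p x (p y)" using assms(2) ancestor_unfold by metis
  moreover have "y \<noteq> 0" using \<open>x \<noteq> y\<close> assms(2) ancestor_root[OF assms(1)] by metis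
  ultimately show False
    using parent_not_descendant[OF assms(1)] ancestor_trans[OF assms(3)] by blast
qed

lemma ancestor_comparable:
  assumes "ancestor p x u" "ancestor p y u"
  shows "ancestor p x y \<or> ancestor p y x"
proof -
  obtain k l where kl: "(p ^^ k) u = x" "(p ^^ l) u = y" using assms by (auto simp: ancestor_def)
  have *: "(p ^^ (b - a)) ((p ^^ a) u) = (p ^^ b) u" if "a \<le> b" for a b
    using that funpow_add[of "b - a" a p] by simp
  show ?thesis
    unfolding ancestor_def using kl *[of k l] *[of l k] by (cases "k \<le> l") auto
qed

text \<open>The ancestors of \<open>u\<close> form a chain, and of two of them with the same parent one would be its own
  descendant.\<close>

lemma parent_inj_on_ancestors:
  assumes p: "p \<in> parent_maps n"
  shows "inj_on p {x. x \<noteq> 0 \<and> ancestor p x u}"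
proof (rule inj_onI)
  have eq: "x = y" if "x \<noteq> 0" "ancestor p x y" "p x = p y" for x y
    using that parent_not_descendant[OF p that(1)] ancestor_unfold[of p x y] by auto
  fix x y assume "x \<in> {x. x \<noteq> 0 \<and> ancestor p x u}" "y \<in> {x. x \<noteq> 0 \<and> ancestor p x u}" "p x = p y"
  then show "x = y" using eq[of x y] eq[of y x] ancestor_comparable[of p x u y] by auto
qed

text \<open>Parent chains that start outside \<open>S\<close> never enter \<open>S\<close>, so they do not depend on how \<open>p\<close> acts on \<open>S\<close>.\<close>

lemma ancestor_agree:
  assumes "\<And>x. x \<notin> S \<Longrightarrow> p x = p0 x" "\<And>x. p0 x \<notin> S" "v \<notin> S"
  shows "ancestor p x v \<longleftrightarrow> ancestor p0 x v" and "ancestor p0 x v \<Longrightarrow> x \<notin> S"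
proof -
  have *: "(p ^^ k) v = (p0 ^^ k) v \<and> (p0 ^^ k) v \<notin> S" for k
    using assms by (induction k) auto
  show "ancestor p x v \<longleftrightarrow> ancestor p0 x v" using * by (auto simp: ancestor_def)
  show "ancestor p0 x v \<Longrightarrow> x \<notin> S" using * by (auto simp: ancestor_def)
qed

text \<open>The vertex \<open>y\<close> is the one at which the parent chain of \<open>j\<close> first leaves \<open>S\<close>.\<close>

lemma ancestor_exit:
  assumes "ancestor p x j" "j \<in> S" "x \<notin> S"
  obtains y where "y \<in> S" "p y \<notin> S" "ancestor p x (p y)"
proof -
  obtain k where "(p ^^ k) j = x" using assms(1) by (auto simp: ancestor_def)
  then have "\<exists>y\<in>S. p y \<notin> S \<and> ancestor p x (p y)"
    using assms(2)
  proof (induction k arbitrary: j)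
    case 0
    then show ?case using assms(3) by simp
  next
    case (Suc k)
    then have k: "(p ^^ k) (p j) = x" by (simp add: funpow_swap1)
    show ?case
    proof (cases "p j \<in> S")
      case True
      then show ?thesis using Suc.IH[OF k] by blast
    next
      case False
      then show ?thesis using k Suc.prems unfolding ancestor_def by blast
    qed
  qed
  then show ?thesis using that by blast
qed

lemma finite_parent_maps: "finite (parent_maps n)"
proof (rule finite_subset)
  show "parent_maps n \<subseteq> {f. \<forall>x. (x \<in> {1..n} \<longrightarrow> f x \<in> {0..n}) \<and> (x \<notin> {1..n} \<longrightarrow> f x = 0)}"
    unfolding parent_maps_def by auto
qed (rule finite_set_of_finite_funs; simp)

text \<open>Termination measure for backtracking.\<close>

definition depth :: "(nat \<Rightarrow> nat) \<Rightarrow> nat \<Rightarrow> nat" where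
  "depth p x = (LEAST k. (p ^^ k) x = 0)"

lemma depth_parent:
  assumes "p \<in> parent_maps n" "x \<noteq> 0"
  shows "depth p (p x) < depth p x"
proof -
  have "\<exists>k. (p ^^ k) x = 0" using assms(1) unfolding parent_maps_def by blast
  then have d: "(p ^^ depth p x) x = 0" unfolding depth_def by (rule LeastI_ex)
  then obtain k where k: "depth p x = Suc k" using assms(2) by (cases "depth p x") auto
  then have "(p ^^ k) (p x) = 0" using d by (simp add: funpow_swap1)
  then have "depth p (p x) \<le> k" unfolding depth_def by (rule Least_le)
  then show ?thesis using k by simp
qed

section \<open>Spanning trees as parent maps\<close>

definition parent_edges :: "nat \<Rightarrow> (nat \<Rightarrow> nat) \<Rightarrow> nat set set" where
  "parent_edges n p = (\<lambda>x. {x, p x}) ` {1..n}"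

lemma parent_edges_iff:
  "{u, v} \<in> parent_edges n p \<longleftrightarrow> u \<in> {1..n} \<and> v = p u \<or> v \<in> {1..n} \<and> u = p v"
  by (auto simp: parent_edges_def image_iff doubleton_eq_iff)

text \<open>A path without repetitions that has gone from a parent to a child can never turn back up, since
  going up would return to the vertex it came from. So it keeps descending.\<close>

lemma descending_path:
  assumes p: "p \<in> parent_maps n"
    and "successively (\<lambda>u v. {u, v} \<in> parent_edges n p) (x # y # ys)"
    and "distinct (x # y # ys)" "y \<in> {1..n}" "p y = x"
  shows "ancestor p y (last (y # ys)) \<and> last (y # ys) \<noteq> 0"
  using assms(2-)
proof (induction ys arbitrary: x y)
  case Nil
  then show ?case by auto
next
  case (Cons z ys)
  have "{y, z} \<in> parent_edges n p" using Cons.prems by simp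
  then have z: "z \<in> {1..n}" "p z = y" using Cons.prems by (auto simp: parent_edges_iff)
  then have "ancestor p z (last (z # ys)) \<and> last (z # ys) \<noteq> 0"
    using Cons.IH[of y z] Cons.prems by simp
  then show ?case
    using z ancestor_trans[OF ancestor_parent, of p z] by auto
qed

text \<open>At least one of the two directions of a cycle starts with a descent from its first vertex \<open>x\<close>: if
  both neighbours of \<open>x\<close> in the cycle were the parent of \<open>x\<close>, they would coincide. Descending all the
  way makes the last vertex a proper descendant of \<open>x\<close> that is still adjacent to \<open>x\<close>, which is
  impossible because it is not a child of \<open>x\<close>.\<close>

lemma parent_edges_acyclic:
  assumes p: "p \<in> parent_maps n"
  shows "\<not> graph_cycle (parent_edges n p) c"
proof
  let ?E = "parent_edges n p"
  have descending: False
    if c: "distinct (x # y # ys)" "ys \<noteq> []" "successively (\<lambda>u v. {u, v} \<in> ?E) (x # y # ys)"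
      "{last ys, x} \<in> ?E" "y \<in> {1..n}" "p y = x" for x y ys
  proof -
    let ?z = "last ys"
    have z: "ancestor p y ?z" "?z \<noteq> 0" "?z \<in> set ys"
      using descending_path[OF p c(3,1,5,6)] c(2) by auto
    have "y \<noteq> 0" using c(5) by auto
    from c(4) show False
      unfolding parent_edges_iff
    proof
      assume zx: "?z \<in> {1..n} \<and> x = p ?z"
      then have "ancestor p y x" using z c(1) by (metis ancestor_unfold distinct.simps(2))
      then show False using parent_not_descendant[OF p \<open>y \<noteq> 0\<close>] c(6) by simp
    next
      assume "x \<in> {1..n} \<and> ?z = p x"
      then have "ancestor p ?z x" by (simp add: ancestor_parent)
      moreover have "ancestor p x ?z" using ancestor_trans[OF ancestor_parent z(1)] c(6) by simp
      ultimately show False using ancestor_antisym[OF p] z(3) c(1) by auto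
    qed
  qed
  assume c: "graph_cycle ?E c"
  then obtain x y ys where xy: "c = x # y # ys" "ys \<noteq> []"
    by (auto simp: graph_cycle_def Suc_le_length_iff numeral_3_eq_3)
  obtain zs z where zs: "ys = zs @ [z]" using xy(2) by (metis rev_exhaust)
  have adj: "{x, y} \<in> ?E" "{z, x} \<in> ?E"
    using c xy zs by (auto simp: graph_cycle_def)
  show False
  proof (cases "y \<in> {1..n} \<and> p y = x")
    case True
    then show False using descending[of x y ys] c xy by (auto simp: graph_cycle_def)
  next
    case False
    then have "p x = y" using adj by (auto simp: parent_edges_iff)
    moreover have "y \<noteq> z" using c xy zs by (auto simp: graph_cycle_def)
    ultimately have "z \<in> {1..n}" "p z = x" using adj by (auto simp: parent_edges_iff)
    \<comment> \<open>The first step ascends, so the cycle is traversed in the other direction.\<close>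
    moreover have "successively (\<lambda>u v. {u, v} \<in> ?E) (x # z # rev zs @ [y])"
    proof -
      have "successively (\<lambda>u v. {u, v} \<in> ?E) (y # zs @ [z])"
        using c xy zs by (auto simp: graph_cycle_def)
      then have "successively (\<lambda>u v. {u, v} \<in> ?E) (rev (y # zs @ [z]))"
        by (subst successively_rev) (simp add: insert_commute)
      then show ?thesis using adj by (simp add: insert_commute)
    qed
    ultimately show False
      using descending[of x z "rev zs @ [y]"] c xy zs adj
      by (auto simp: graph_cycle_def insert_commute)
  qed
qed

text \<open>A first step to a child would force the whole path to descend, and then it could not end at \<open>0\<close>.\<close>

lemma simple_path_root_parent:
  assumes p: "p \<in> parent_maps n" and path: "simple_path (parent_edges n p) x 0 xs" and "x \<noteq> 0"
  shows "\<exists>ys. xs = x # ys \<and> simple_path (parent_edges n p) (p x) 0 ys"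
proof -
  obtain y ys where xs: "xs = x # y # ys"
    using path \<open>x \<noteq> 0\<close> by (cases xs rule: remdups_adj.cases) (auto simp: simple_path_def)
  have "\<not> (y \<in> {1..n} \<and> p y = x)"
    using descending_path[OF p, of x y ys] path xs by (auto simp: simple_path_def)
  then have "y = p x" using path xs by (auto simp: simple_path_def parent_edges_iff)
  then show ?thesis using path xs by (auto simp: simple_path_def)
qed

lemma simple_path_root_unique:
  assumes p: "p \<in> parent_maps n"
  shows "simple_path (parent_edges n p) x 0 xs \<Longrightarrow> simple_path (parent_edges n p) x 0 ys \<Longrightarrow> xs = ys"
proof (induction x arbitrary: xs ys rule: parent_induct[OF p])
  case 1
  have "zs = [0]" if "simple_path (parent_edges n p) 0 0 zs" for zs
    using that by (cases zs; cases "tl zs" rule: rev_cases) (auto simp: simple_path_def)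
  then show ?case using 1 by blast
next
  case (2 x)
  then show ?case using simple_path_root_parent[OF p] by blast
qed

lemma simple_path_root_exists:
  assumes p: "p \<in> parent_maps n"
  shows "x \<le> n \<Longrightarrow> \<exists>xs. simple_path (parent_edges n p) x 0 xs \<and> set xs = {y. ancestor p y x}
    \<and> (x \<noteq> 0 \<longrightarrow> xs ! 1 = p x)"
proof (induction x rule: parent_induct[OF p])
  case 1
  show ?case using ancestor_root[OF p] by (intro exI[of _ "[0]"]) (auto simp: simple_path_def)
next
  case (2 x)
  have "p x \<le> n" using p by (simp add: parent_maps_def)
  then obtain xs where xs: "simple_path (parent_edges n p) (p x) 0 xs" "set xs = {y. ancestor p y (p x)}"
    using 2 by blast
  have "x \<notin> set xs" using xs parent_not_descendant[OF p 2(1)] by auto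
  moreover have "{x, p x} \<in> parent_edges n p" using 2 by (auto simp: parent_edges_def)
  moreover obtain ys where "xs = p x # ys" using xs(1) by (cases xs) (auto simp: simple_path_def)
  ultimately have "simple_path (parent_edges n p) x 0 (x # xs)" "(x # xs) ! 1 = p x"
    using xs by (auto simp: simple_path_def)
  moreover have "set (x # xs) = {y. ancestor p y x}"
    using xs(2) by (auto simp: ancestor_unfold[of p _ x])
  ultimately show ?case by blast
qed

lemma root_path_parent_edges:
  assumes p: "p \<in> parent_maps n" and "x \<le> n"
  shows "tree_le (parent_edges n p) y x \<longleftrightarrow> ancestor p y x"
    and "x \<noteq> 0 \<Longrightarrow> par (parent_edges n p) x = p x"
proof -
  obtain xs where xs: "simple_path (parent_edges n p) x 0 xs" "set xs = {y. ancestor p y x}"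
    "x \<noteq> 0 \<longrightarrow> xs ! 1 = p x"
    using simple_path_root_exists[OF assms] by blast
  have "root_path (parent_edges n p) x = xs"
    unfolding root_path_def using xs(1) simple_path_root_unique[OF p] by blast
  then show "tree_le (parent_edges n p) y x \<longleftrightarrow> ancestor p y x"
    "x \<noteq> 0 \<Longrightarrow> par (parent_edges n p) x = p x"
    using xs by (auto simp: tree_le_def par_def)
qed

lemma simple_path_if_rtrancl:
  assumes "(x, y) \<in> {(u, v). {u, v} \<in> E}\<^sup>*"
  shows "\<exists>xs. simple_path E x y xs"
  using assms
proof (induction rule: converse_rtrancl_induct)
  case base
  show ?case by (rule exI[of _ "[y]"]) (simp add: simple_path_def)
next
  case (step x z)
  then obtain xs where xs: "simple_path E z y xs" by blast
  show ?case
  proof (cases "x \<in> set xs")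
    case True
    then obtain as bs where "xs = as @ x # bs" by (meson split_list)
    then have "simple_path E x y (x # bs)"
      using xs by (auto simp: simple_path_def successively_append_iff)
    then show ?thesis by blast
  next
    case False
    then have "simple_path E x y (x # xs)"
      using xs step(1) by (auto simp: simple_path_def successively_Cons)
    then show ?thesis by blast
  qed
qed

lemma rtrancl_if_simple_path:
  assumes "simple_path E x y xs"
  shows "(x, y) \<in> {(u, v). {u, v} \<in> E}\<^sup>*"
  using assms
proof (induction xs arbitrary: x)
  case Nil
  then show ?case by (simp add: simple_path_def)
next
  case (Cons z xs)
  show ?case
  proof (cases xs)
    case Nil
    then show ?thesis using Cons.prems by (auto simp: simple_path_def)
  next
    case (Cons z' zs)
    then have "simple_path E z' y xs" "{x, z'} \<in> E" using Cons.prems by (auto simp: simple_path_def)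
    then show ?thesis using Cons.IH by (meson case_prodI converse_rtrancl_into_rtrancl mem_Collect_eq)
  qed
qed

lemma parent_edges_reach:
  assumes p: "p \<in> parent_maps n"
  shows "x \<le> n \<Longrightarrow> (x, 0) \<in> {(u, v). {u, v} \<in> parent_edges n p}\<^sup>*"
  using simple_path_root_exists[OF p, of x] by (auto intro: rtrancl_if_simple_path)

lemma parent_edges_connected:
  assumes p: "p \<in> parent_maps n" and "x \<le> n" "y \<le> n"
  shows "(x, y) \<in> {(u, v). {u, v} \<in> parent_edges n p}\<^sup>*"
proof -
  have "sym ({(u, v). {u, v} \<in> parent_edges n p}\<^sup>*)"
    by (intro sym_rtrancl symI) (auto simp: insert_commute)
  then have "(0, y) \<in> {(u, v). {u, v} \<in> parent_edges n p}\<^sup>*"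
    using parent_edges_reach[OF p assms(3)] by (meson symD)
  then show ?thesis using parent_edges_reach[OF p assms(2)] by (meson rtrancl_trans)
qed

lemma parent_edges_tree:
  assumes p: "p \<in> parent_maps n"
  shows "is_tree {0..n} (parent_edges n p)"
proof -
  have "parent_edges n p \<subseteq> nsets {0..n} 2"
  proof
    fix e assume "e \<in> parent_edges n p"
    then obtain x where x: "x \<in> {1..n}" "e = {x, p x}" by (auto simp: parent_edges_def)
    then have "x \<noteq> p x" using parent_not_descendant[OF p, of x] by auto
    moreover have "p x \<le> n" using p by (auto simp: parent_maps_def)
    ultimately show "e \<in> nsets {0..n} 2" using x by (auto simp: nsets_def)
  qed
  moreover have "graph_connected {0..n} (parent_edges n p)"
    unfolding graph_connected_def using simple_path_if_rtrancl[OF parent_edges_connected[OF p]] by simp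
  ultimately show ?thesis using parent_edges_acyclic[OF p] by (auto simp: is_tree_def)
qed

text \<open>The parent of a vertex is chosen as a neighbour at smaller distance from \<open>0\<close>.\<close>

lemma tree_eq_parent_edges:
  assumes T: "is_tree {0..n} T"
  shows "\<exists>p\<in>parent_maps n. T = parent_edges n p"
proof -
  define R where "R = {(u, v). {u, v} \<in> T}"
  define d where "d x = (LEAST k. (x, 0) \<in> R ^^ k)" for x
  have nsets: "T \<subseteq> nsets {0..n} 2" using T by (simp add: is_tree_def)
  have R_le: "x \<le> n \<and> y \<le> n \<and> x \<noteq> y" if "(x, y) \<in> R" for x y
  proof -
    have "{x, y} \<in> nsets {0..n} 2" using that nsets unfolding R_def by blast
    then show ?thesis by (auto simp: nsets_def card_insert_if split: if_splits)
  qed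
  have "\<exists>y. (x, y) \<in> R \<and> d y < d x" if x: "x \<in> {1..n}" for x
  proof -
    have "x \<in> {0..n}" "0 \<in> {0..n}" using x by auto
    then obtain xs where "simple_path T x 0 xs"
      using T unfolding is_tree_def graph_connected_def by blast
    then have "(x, 0) \<in> R\<^sup>*" unfolding R_def by (rule rtrancl_if_simple_path)
    then have "\<exists>k. (x, 0) \<in> R ^^ k" by (simp add: rtrancl_power)
    then have dx: "(x, 0) \<in> R ^^ d x" unfolding d_def by (rule LeastI_ex)
    then obtain k where k: "d x = Suc k" using x by (cases "d x") auto
    then obtain y where y: "(x, y) \<in> R" "(y, 0) \<in> R ^^ k" using dx relpow_Suc_E2 by metis
    then have "d y \<le> k" unfolding d_def by (simp add: Least_le)
    then show ?thesis using y k by auto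
  qed
  then obtain f where f: "\<And>x. x \<in> {1..n} \<Longrightarrow> (x, f x) \<in> R \<and> d (f x) < d x" by metis
  define p where "p x = (if x \<in> {1..n} then f x else 0)" for x
  have "\<exists>k. (p ^^ k) x = 0" for x
  proof (induction "d x" arbitrary: x rule: less_induct)
    case less
    show ?case
    proof (cases "x \<in> {1..n}")
      case True
      then have "p x = f x" unfolding p_def by (simp only: if_True)
      then have "d (p x) < d x" using f[OF True] by simp
      then obtain k where "(p ^^ k) (p x) = 0" using less by blast
      then have "(p ^^ Suc k) x = 0" by (simp add: funpow_swap1)
      then show ?thesis by blast
    next
      case False
      then have "(p ^^ 1) x = 0" by (auto simp: p_def)
      then show ?thesis by blast
    qed
  qed
  moreover have "p x \<le> n" for x using f[of x] R_le[of x "f x"] by (simp add: p_def)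
  moreover have "p x = 0" if "x \<notin> {1..n}" for x unfolding p_def using that by (rule if_not_P)
  ultimately have p: "p \<in> parent_maps n" unfolding parent_maps_def by blast
  have sub: "parent_edges n p \<subseteq> T"
  proof
    fix e assume "e \<in> parent_edges n p"
    then obtain x where x: "x \<in> {1..n}" "e = {x, p x}" unfolding parent_edges_def by blast
    then have "p x = f x" unfolding p_def by (simp only: if_True)
    then show "e \<in> T" using f[OF x(1)] x(2) by (simp add: R_def)
  qed
  \<comment> \<open>A further edge of T would close a cycle with the path that joins its ends in the subtree.\<close>
  have "T \<subseteq> parent_edges n p"
  proof
    fix e assume e: "e \<in> T"
    then have "card e = 2" using nsets unfolding nsets_def by blast
    then obtain a b where ab: "e = {a, b}" by (meson card_2_iff)
    then have "(a, b) \<in> R" using e by (simp add: R_def)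
    then have le: "a \<le> n" "b \<le> n" "a \<noteq> b" using R_le[of a b] by simp_all
    then obtain xs where xs: "simple_path (parent_edges n p) a b xs"
      using simple_path_if_rtrancl[OF parent_edges_connected[OF p]] by blast
    show "e \<in> parent_edges n p"
    proof (rule ccontr)
      assume notin: "e \<notin> parent_edges n p"
      have "3 \<le> length xs"
      proof (cases xs rule: remdups_adj.cases)
        case (3 x y ys)
        then show ?thesis using xs notin ab by (cases ys) (auto simp: simple_path_def)
      qed (use xs le in \<open>auto simp: simple_path_def\<close>)
      moreover have "successively (\<lambda>u v. {u, v} \<in> T) xs"
        using xs sub by (auto simp: simple_path_def intro: successively_mono)
      ultimately have "graph_cycle T xs"
        using xs e ab by (auto simp: graph_cycle_def simple_path_def insert_commute)
      then show False using T by (auto simp: is_tree_def)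
    qed
  qed
  then show ?thesis using p sub by blast
qed

lemma inj_on_parent_edge:
  assumes p: "p \<in> parent_maps n"
  shows "inj_on (\<lambda>x. {x, p x}) {1..n}"
proof (rule inj_onI)
  fix x y assume xy: "x \<in> {1..n}" "y \<in> {1..n}" "{x, p x} = {y, p y}"
  show "x = y"
  proof (rule ccontr)
    assume "x \<noteq> y"
    then have "p x = y" "p y = x" using xy by (auto simp: doubleton_eq_iff)
    then have "ancestor p x (p x)" using ancestor_parent[of p y] by simp
    then show False using parent_not_descendant[OF p, of x] xy by simp
  qed
qed

text \<open>Injectivity holds because the parent map is read off the tree as \<open>par\<close>. The weights are written
  \<open>w {p x, x}\<close>, parent first, to match the capacities \<open>W v j\<close> used below.\<close>

lemma bij_betw_parent_edges:
  "bij_betw (parent_edges n) {p \<in> parent_maps n. \<forall>x\<in>{1..n}. w {p x, x} \<noteq> (0 :: nat)} (SPT n w)"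
proof (rule bij_betw_imageI)
  show "inj_on (parent_edges n) {p \<in> parent_maps n. \<forall>x\<in>{1..n}. w {p x, x} \<noteq> 0}"
  proof (rule inj_onI, rule ext)
    fix p p' x
    assume "p \<in> {p \<in> parent_maps n. \<forall>x\<in>{1..n}. w {p x, x} \<noteq> 0}"
      "p' \<in> {p \<in> parent_maps n. \<forall>x\<in>{1..n}. w {p x, x} \<noteq> 0}"
      and eq: "parent_edges n p = parent_edges n p'"
    then have p: "p \<in> parent_maps n" "p' \<in> parent_maps n" by auto
    show "p x = p' x"
    proof (cases "x \<in> {1..n}")
      case True
      then show ?thesis
        using root_path_parent_edges(2)[OF p(1), of x] root_path_parent_edges(2)[OF p(2), of x] eq by auto
    next
      case False
      then show ?thesis using p by (auto simp: parent_maps_def)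
    qed
  qed
  show "parent_edges n ` {p \<in> parent_maps n. \<forall>x\<in>{1..n}. w {p x, x} \<noteq> 0} = SPT n w"
  proof (intro equalityI subsetI)
    fix T assume "T \<in> parent_edges n ` {p \<in> parent_maps n. \<forall>x\<in>{1..n}. w {p x, x} \<noteq> 0}"
    then show "T \<in> SPT n w"
      using parent_edges_tree by (auto simp: SPT_def parent_edges_def insert_commute Suc_le_eq)
  next
    fix T assume T: "T \<in> SPT n w"
    then obtain p where p: "p \<in> parent_maps n" "T = parent_edges n p"
      using tree_eq_parent_edges[of n T] unfolding SPT_def by blast
    moreover have "w {p x, x} \<noteq> 0" if "x \<in> {1..n}" for x
    proof -
      have "{p x, x} \<in> T" using that p by (auto simp: parent_edges_def insert_commute)
      then show ?thesis using T by (auto simp: SPT_def)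
    qed
    ultimately show "T \<in> parent_edges n ` {p \<in> parent_maps n. \<forall>x\<in>{1..n}. w {p x, x} \<noteq> 0}" by blast
  qed
qed

section \<open>Parking functions relative to a burnt set\<close>

text \<open>Parking functions for the unburnt set \<open>S\<close>, where \<open>W v j\<close> is the number of available edges from \<open>v\<close>
  to \<open>j\<close>. For burnt \<open>v\<close> this may be smaller than the multiplicity in the graph, because edges get
  discarded during the search. For \<open>S = {1..n}\<close> and the multiplicities of the graph this is \<open>PF\<close>.\<close>

definition parking :: "nat \<Rightarrow> nat set \<Rightarrow> (nat \<Rightarrow> nat \<Rightarrow> nat) \<Rightarrow> (nat \<Rightarrow> nat) set" where
  "parking n S W = {\<alpha> \<in> S \<rightarrow>\<^sub>E UNIV. \<forall>U. U \<subseteq> S \<and> U \<noteq> {} \<longrightarrow>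
     (\<exists>i\<in>U. \<alpha> i < (\<Sum>v\<in>{0..n} - U. W v i))}"

text \<open>The edges counted are those with an end in \<open>S\<close>: edges inside \<open>S\<close> with their multiplicity in the
  graph, edges to burnt vertices with their capacity.\<close>

definition parking_rsum ::
  "nat \<Rightarrow> (nat set \<Rightarrow> nat) \<Rightarrow> nat set \<Rightarrow> (nat \<Rightarrow> nat \<Rightarrow> nat) \<Rightarrow> (nat \<Rightarrow> nat) \<Rightarrow> int" where
  "parking_rsum n w S W \<alpha> = int (\<Sum>e\<in>nsets S 2. w e) + int (\<Sum>j\<in>S. \<Sum>v\<in>{0..n} - S. W v j)
     - int (card S) - int (\<Sum>j\<in>S. \<alpha> j)"

definition parking_enum ::
  "nat \<Rightarrow> (nat set \<Rightarrow> nat) \<Rightarrow> nat set \<Rightarrow> (nat \<Rightarrow> nat \<Rightarrow> nat) \<Rightarrow> int poly" where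
  "parking_enum n w S W = (\<Sum>\<alpha>\<in>parking n S W. q_var ^ nat (parking_rsum n w S W \<alpha>))"

abbreviation discard :: "('a \<Rightarrow> 'b \<Rightarrow> nat) \<Rightarrow> 'a \<Rightarrow> 'b \<Rightarrow> 'a \<Rightarrow> 'b \<Rightarrow> nat" where
  "discard W u i \<equiv> W(u := (W u)(i := 0))"

lemma sum_nsets2_insert:
  assumes "finite S" "i \<notin> S"
  shows "(\<Sum>e\<in>nsets (insert i S) 2. w e) = (\<Sum>e\<in>nsets S 2. w e) + (\<Sum>j\<in>S. (w {i, j} :: nat))"
proof -
  have split: "nsets (insert i S) 2 = nsets S 2 \<union> (\<lambda>j. {i, j}) ` S"
    using assms by (auto simp: nsets_def card_2_iff doubleton_eq_iff)
  have "(\<Sum>e\<in>nsets (insert i S) 2. w e) = (\<Sum>e\<in>nsets S 2. w e) + (\<Sum>e\<in>(\<lambda>j. {i, j}) ` S. w e)"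
    unfolding split using assms
    by (intro sum.union_disjoint) (auto simp: nsets_def finite_imp_finite_nsets)
  also have "(\<Sum>e\<in>(\<lambda>j. {i, j}) ` S. w e) = (\<Sum>j\<in>S. w {i, j})"
    by (subst sum.reindex) (auto simp: inj_on_def doubleton_eq_iff)
  finally show ?thesis .
qed

lemma finite_parking:
  assumes "finite S" shows "finite (parking n S W)"
proof (rule finite_subset)
  show "parking n S W \<subseteq> (\<Pi>\<^sub>E i\<in>S. {..\<Sum>v\<in>{0..n} - {i}. W v i})"
  proof
    fix \<alpha> assume a: "\<alpha> \<in> parking n S W"
    have "\<alpha> i \<le> (\<Sum>v\<in>{0..n} - {i}. W v i)" if "i \<in> S" for i
    proof -
      have "\<exists>k\<in>{i}. \<alpha> k < (\<Sum>v\<in>{0..n} - {i}. W v k)" using a that unfolding parking_def by blast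
      then show ?thesis by simp
    qed
    then show "\<alpha> \<in> (\<Pi>\<^sub>E i\<in>S. {..\<Sum>v\<in>{0..n} - {i}. W v i})"
      using a by (auto simp: parking_def PiE_iff)
  qed
qed (use assms in \<open>auto intro: finite_PiE\<close>)

lemma parking_rsum_remove:
  assumes "S \<subseteq> {0..n}" "i \<in> S" "\<And>j. j \<in> S - {i} \<Longrightarrow> W i j = w {i, j}"
  shows "parking_rsum n w S W \<alpha>
    = int (\<Sum>v\<in>{0..n} - S. W v i) - 1 - int (\<alpha> i) + parking_rsum n w (S - {i}) W \<alpha>"
proof -
  let ?S = "S - {i}"
  have fin: "finite S" using assms(1) finite_subset by blast
  have compl: "{0..n} - ?S = insert i ({0..n} - S)" using assms by auto
  have e: "(\<Sum>e\<in>nsets S 2. w e) = (\<Sum>e\<in>nsets ?S 2. w e) + (\<Sum>j\<in>?S. w {i, j})"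
    using sum_nsets2_insert[of ?S i w] fin assms(2) by (simp add: insert_absorb)
  have "(\<Sum>j\<in>?S. \<Sum>v\<in>{0..n} - ?S. W v j) = (\<Sum>j\<in>?S. w {i, j} + (\<Sum>v\<in>{0..n} - S. W v j))"
    unfolding compl using assms by (intro sum.cong) auto
  also have "\<dots> = (\<Sum>j\<in>?S. w {i, j}) + (\<Sum>j\<in>?S. \<Sum>v\<in>{0..n} - S. W v j)"
    by (rule sum.distrib)
  finally have c: "(\<Sum>j\<in>?S. \<Sum>v\<in>{0..n} - ?S. W v j)
      = (\<Sum>j\<in>?S. w {i, j}) + (\<Sum>j\<in>?S. \<Sum>v\<in>{0..n} - S. W v j)" .
  have "int (card S) = int (card ?S) + 1"
    using fin assms(2) by (metis card_Suc_Diff1 of_nat_Suc add.commute)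
  then show ?thesis
    unfolding parking_rsum_def e c
    using sum.remove[OF fin assms(2), of "\<lambda>j. \<Sum>v\<in>{0..n} - S. W v j"] sum.remove[OF fin assms(2), of \<alpha>]
    by simp
qed

context
  fixes n :: nat and w :: "nat set \<Rightarrow> nat" and S :: "nat set" and W :: "nat \<Rightarrow> nat \<Rightarrow> nat" and i u :: nat
  assumes S: "S \<subseteq> {0..n}" and i: "i \<in> S" and u: "u \<in> {0..n} - S"
begin

private lemma finite_S: "finite S" using S finite_subset by blast

private lemma sum_delete:
  assumes "U \<subseteq> S"
  shows "(\<Sum>v\<in>{0..n} - U. W v i) = W u i + (\<Sum>v\<in>{0..n} - U. discard W u i v i)"
    and "j \<noteq> i \<Longrightarrow> (\<Sum>v\<in>{0..n} - U. discard W u i v j) = (\<Sum>v\<in>{0..n} - U. W v j)"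
proof -
  have uU: "u \<in> {0..n} - U" using u assms by auto
  have "(\<Sum>v\<in>{0..n} - U - {u}. discard W u i v i) = (\<Sum>v\<in>{0..n} - U - {u}. W v i)"
    by (intro sum.cong) auto
  then show "(\<Sum>v\<in>{0..n} - U. W v i) = W u i + (\<Sum>v\<in>{0..n} - U. discard W u i v i)"
    using sum.remove[OF _ uU, of "\<lambda>v. W v i"] sum.remove[OF _ uU, of "\<lambda>v. discard W u i v i"] by simp
  show "j \<noteq> i \<Longrightarrow> (\<Sum>v\<in>{0..n} - U. discard W u i v j) = (\<Sum>v\<in>{0..n} - U. W v j)"
    by (intro sum.cong) auto
qed

text \<open>Discarding the edges between \<open>u\<close> and \<open>i\<close> lowers every bound on \<open>\<alpha> i\<close> by \<open>W u i\<close>, since \<open>u\<close> lies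
  outside each test set \<open>U \<subseteq> S\<close>, and leaves the bounds at all other vertices alone.\<close>

lemma parking_delete_iff:
  assumes "\<beta> \<in> S \<rightarrow>\<^sub>E UNIV"
  shows "\<beta>(i := \<beta> i + W u i) \<in> parking n S W \<longleftrightarrow> \<beta> \<in> parking n S (discard W u i)"
proof -
  have "(\<beta>(i := \<beta> i + W u i)) j < (\<Sum>v\<in>{0..n} - U. W v j) \<longleftrightarrow> \<beta> j < (\<Sum>v\<in>{0..n} - U. discard W u i v j)"
    if "U \<subseteq> S" "j \<in> U" for U j
    using sum_delete(1)[OF that(1)] sum_delete(2)[OF that(1), of j] by (cases "j = i") auto
  moreover have "\<beta>(i := \<beta> i + W u i) \<in> S \<rightarrow>\<^sub>E UNIV"
    using assms i by (auto simp: PiE_iff extensional_def)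
  ultimately show ?thesis
    using assms unfolding parking_def by (auto 0 4)
qed

lemma parking_rsum_delete:
  "parking_rsum n w S W (\<beta>(i := \<beta> i + W u i)) = parking_rsum n w S (discard W u i) \<beta>"
proof -
  have "(\<Sum>j\<in>S - {i}. \<Sum>v\<in>{0..n} - S. discard W u i v j) = (\<Sum>j\<in>S - {i}. \<Sum>v\<in>{0..n} - S. W v j)"
    by (intro sum.cong sum_delete(2)) auto
  then have "(\<Sum>j\<in>S. \<Sum>v\<in>{0..n} - S. W v j) = W u i + (\<Sum>j\<in>S. \<Sum>v\<in>{0..n} - S. discard W u i v j)"
    using sum.remove[OF finite_S i, of "\<lambda>j. \<Sum>v\<in>{0..n} - S. W v j"]
      sum.remove[OF finite_S i, of "\<lambda>j. \<Sum>v\<in>{0..n} - S. discard W u i v j"] sum_delete(1)[of S] by simp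
  moreover have "(\<Sum>j\<in>S. (\<beta>(i := \<beta> i + W u i)) j) = W u i + (\<Sum>j\<in>S. \<beta> j)"
  proof -
    have "(\<Sum>j\<in>S - {i}. (\<beta>(i := \<beta> i + W u i)) j) = (\<Sum>j\<in>S - {i}. \<beta> j)"
      by (intro sum.cong) auto
    then show ?thesis
      using sum.remove[OF finite_S i, of "\<beta>(i := \<beta> i + W u i)"] sum.remove[OF finite_S i, of \<beta>] by simp
  qed
  ultimately show ?thesis unfolding parking_rsum_def by simp
qed

text \<open>If the value at \<open>i\<close> is below \<open>W u i\<close>, then \<open>i\<close> itself is a witness for every test set that contains
  it, so only the test sets inside \<open>S - {i}\<close> constrain the function.\<close>

lemma parking_burn_iff:
  assumes "\<beta> \<in> (S - {i}) \<rightarrow>\<^sub>E UNIV" "a < W u i"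
  shows "\<beta>(i := a) \<in> parking n S W \<longleftrightarrow> \<beta> \<in> parking n (S - {i}) W"
proof
  assume L: "\<beta>(i := a) \<in> parking n S W"
  show "\<beta> \<in> parking n (S - {i}) W"
    unfolding parking_def
  proof (intro CollectI conjI assms allI impI)
    fix U assume U: "U \<subseteq> S - {i} \<and> U \<noteq> {}"
    then obtain j where "j \<in> U" "(\<beta>(i := a)) j < (\<Sum>v\<in>{0..n} - U. W v j)"
      using L unfolding parking_def by blast
    moreover from this have "j \<noteq> i" using U by auto
    ultimately show "\<exists>j\<in>U. \<beta> j < (\<Sum>v\<in>{0..n} - U. W v j)" by auto
  qed
next
  assume R: "\<beta> \<in> parking n (S - {i}) W"
  show "\<beta>(i := a) \<in> parking n S W"
    unfolding parking_def
  proof (intro CollectI conjI allI impI)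
    show "\<beta>(i := a) \<in> S \<rightarrow>\<^sub>E UNIV" using assms i by (auto simp: PiE_iff extensional_def)
    fix U assume U: "U \<subseteq> S \<and> U \<noteq> {}"
    show "\<exists>j\<in>U. (\<beta>(i := a)) j < (\<Sum>v\<in>{0..n} - U. W v j)"
    proof (cases "i \<in> U")
      case True
      then show ?thesis using sum_delete(1)[of U] U assms(2) by (intro bexI[of _ i]) auto
    next
      case False
      then have "U \<subseteq> S - {i}" using U by auto
      then obtain j where "j \<in> U" "\<beta> j < (\<Sum>v\<in>{0..n} - U. W v j)"
        using R U unfolding parking_def by blast
      then show ?thesis using False by (intro bexI[of _ j]) auto
    qed
  qed
qed

lemma parking_large_eq:
  "{\<alpha> \<in> parking n S W. W u i \<le> \<alpha> i} = (\<lambda>\<beta>. \<beta>(i := \<beta> i + W u i)) ` parking n S (discard W u i)"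
proof (intro equalityI subsetI)
  fix \<alpha> assume a: "\<alpha> \<in> {\<alpha> \<in> parking n S W. W u i \<le> \<alpha> i}"
  define \<beta> where "\<beta> = \<alpha>(i := \<alpha> i - W u i)"
  have "\<alpha> = \<beta>(i := \<beta> i + W u i)" using a by (auto simp: \<beta>_def)
  moreover have "\<beta> \<in> S \<rightarrow>\<^sub>E UNIV" using a i by (auto simp: \<beta>_def parking_def PiE_iff extensional_def)
  ultimately show "\<alpha> \<in> (\<lambda>\<beta>. \<beta>(i := \<beta> i + W u i)) ` parking n S (discard W u i)"
    using parking_delete_iff a by blast
next
  fix \<alpha> assume "\<alpha> \<in> (\<lambda>\<beta>. \<beta>(i := \<beta> i + W u i)) ` parking n S (discard W u i)"
  then obtain \<beta> where "\<beta> \<in> parking n S (discard W u i)" "\<alpha> = \<beta>(i := \<beta> i + W u i)" by blast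
  moreover from this have "\<beta> \<in> S \<rightarrow>\<^sub>E UNIV" by (simp add: parking_def)
  ultimately show "\<alpha> \<in> {\<alpha> \<in> parking n S W. W u i \<le> \<alpha> i}" using parking_delete_iff by auto
qed

lemma parking_small_eq:
  "{\<alpha> \<in> parking n S W. \<alpha> i < W u i}
    = (\<lambda>(a, \<beta>). \<beta>(i := a)) ` ({..<W u i} \<times> parking n (S - {i}) W)"
proof (intro equalityI subsetI)
  fix \<alpha> assume a: "\<alpha> \<in> {\<alpha> \<in> parking n S W. \<alpha> i < W u i}"
  define \<beta> where "\<beta> = \<alpha>(i := undefined)"
  have "\<alpha> = \<beta>(i := \<alpha> i)" by (auto simp: \<beta>_def)
  moreover have "\<beta> \<in> (S - {i}) \<rightarrow>\<^sub>E UNIV" using a i by (auto simp: \<beta>_def parking_def PiE_iff extensional_def)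
  ultimately have "\<beta> \<in> parking n (S - {i}) W" using parking_burn_iff[of \<beta> "\<alpha> i"] a by simp
  then show "\<alpha> \<in> (\<lambda>(a, \<beta>). \<beta>(i := a)) ` ({..<W u i} \<times> parking n (S - {i}) W)"
    using a \<open>\<alpha> = \<beta>(i := \<alpha> i)\<close> by (intro image_eqI[of _ _ "(\<alpha> i, \<beta>)"]) auto
next
  fix \<alpha> assume "\<alpha> \<in> (\<lambda>(a, \<beta>). \<beta>(i := a)) ` ({..<W u i} \<times> parking n (S - {i}) W)"
  then obtain a \<beta> where "a < W u i" "\<beta> \<in> parking n (S - {i}) W" "\<alpha> = \<beta>(i := a)" by auto
  moreover from this have "\<beta> \<in> (S - {i}) \<rightarrow>\<^sub>E UNIV" by (simp add: parking_def)
  ultimately show "\<alpha> \<in> {\<alpha> \<in> parking n S W. \<alpha> i < W u i}" using parking_burn_iff by auto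
qed

private lemma inj_large: "inj_on (\<lambda>\<beta>. \<beta>(i := \<beta> i + W u i)) (parking n S (discard W u i))"
proof (rule inj_onI, rule ext)
  fix \<beta> \<gamma> :: "nat \<Rightarrow> nat" and x
  assume "\<beta>(i := \<beta> i + W u i) = \<gamma>(i := \<gamma> i + W u i)"
  then show "\<beta> x = \<gamma> x" by (cases "x = i") (auto dest!: fun_cong[where x = x])
qed

private lemma inj_small:
  "inj_on (\<lambda>(a, \<beta>). \<beta>(i := a)) ({..<W u i} \<times> parking n (S - {i}) W)"
proof (rule inj_onI, clarify, rule conjI)
  fix a b :: nat and \<beta> \<gamma> :: "nat \<Rightarrow> nat"
  assume eq: "\<beta>(i := a) = \<gamma>(i := b)" and \<beta>: "\<beta> \<in> parking n (S - {i}) W" and \<gamma>: "\<gamma> \<in> parking n (S - {i}) W"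
  show "a = b" using fun_cong[OF eq, of i] by simp
  show "\<beta> = \<gamma>"
  proof
    fix x show "\<beta> x = \<gamma> x"
      using fun_cong[OF eq, of x] \<beta> \<gamma> by (cases "x = i") (auto simp: parking_def PiE_iff extensional_def)
  qed
qed

lemma parking_rsum_burn:
  assumes "\<And>j. j \<in> S - {i} \<Longrightarrow> W i j = w {i, j}" "a < W u i"
  shows "parking_rsum n w S W (\<beta>(i := a))
    = int ((\<Sum>v\<in>{0..n} - S - {u}. W v i) + (W u i - Suc a)) + parking_rsum n w (S - {i}) W \<beta>"
proof -
  have "parking_rsum n w (S - {i}) W (\<beta>(i := a)) = parking_rsum n w (S - {i}) W \<beta>"
  proof -
    have "(\<Sum>j\<in>S - {i}. (\<beta>(i := a)) j) = (\<Sum>j\<in>S - {i}. \<beta> j)" by (intro sum.cong) auto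
    then show ?thesis unfolding parking_rsum_def by simp
  qed
  moreover have "(\<Sum>v\<in>{0..n} - S. W v i) = W u i + (\<Sum>v\<in>{0..n} - S - {u}. W v i)"
    using u by (intro sum.remove) auto
  ultimately show ?thesis
    using parking_rsum_remove[of S n i W w "\<beta>(i := a)"] S i assms by simp
qed

text \<open>Non-negativity is carried along the same recursion as the generating functions; it is what allows
  the exponents, which are truncated to natural numbers, to be added in \<open>parking_enum_step\<close>.\<close>

lemma parking_rsum_nonneg_step:
  assumes sym: "\<And>j. j \<in> S - {i} \<Longrightarrow> W i j = w {i, j}"
    and del: "\<And>\<beta>. \<beta> \<in> parking n S (discard W u i) \<Longrightarrow> 0 \<le> parking_rsum n w S (discard W u i) \<beta>"
    and burn: "\<And>\<beta>. \<beta> \<in> parking n (S - {i}) W \<Longrightarrow> 0 \<le> parking_rsum n w (S - {i}) W \<beta>"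
    and \<alpha>: "\<alpha> \<in> parking n S W"
  shows "0 \<le> parking_rsum n w S W \<alpha>"
proof (cases "\<alpha> i < W u i")
  case True
  then have "\<alpha> \<in> {\<alpha> \<in> parking n S W. \<alpha> i < W u i}" using \<alpha> by simp
  then obtain a \<beta> where "a < W u i" "\<beta> \<in> parking n (S - {i}) W" "\<alpha> = \<beta>(i := a)"
    unfolding parking_small_eq by auto
  then show ?thesis
    using parking_rsum_burn[OF sym, of a \<beta>] burn[of \<beta>] by (metis add_nonneg_nonneg of_nat_0_le_iff)
next
  case False
  then have "\<alpha> \<in> {\<alpha> \<in> parking n S W. W u i \<le> \<alpha> i}" using \<alpha> by simp
  then obtain \<beta> where "\<beta> \<in> parking n S (discard W u i)" "\<alpha> = \<beta>(i := \<beta> i + W u i)"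
    unfolding parking_large_eq by auto
  then show ?thesis using parking_rsum_delete[of \<beta>] del by simp
qed

text \<open>The two summands come from the functions with \<open>\<alpha> i \<ge> W u i\<close> and \<open>\<alpha> i < W u i\<close>.\<close>

lemma parking_enum_step:
  assumes sym: "\<And>j. j \<in> S - {i} \<Longrightarrow> W i j = w {i, j}"
    and burn: "\<And>\<beta>. \<beta> \<in> parking n (S - {i}) W \<Longrightarrow> 0 \<le> parking_rsum n w (S - {i}) W \<beta>"
  shows "parking_enum n w S W = parking_enum n w S (discard W u i)
    + q_var ^ (\<Sum>v\<in>{0..n} - S - {u}. W v i) * q_int (W u i) * parking_enum n w (S - {i}) W"
proof -
  let ?m = "W u i" and ?c = "\<Sum>v\<in>{0..n} - S - {u}. W v i" and ?P = "parking n (S - {i}) W"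
  let ?t = "\<lambda>\<alpha>. q_var ^ nat (parking_rsum n w S W \<alpha>)"
  have "parking n S W = {\<alpha> \<in> parking n S W. ?m \<le> \<alpha> i} \<union> {\<alpha> \<in> parking n S W. \<alpha> i < ?m}"
    by auto
  then have "parking_enum n w S W
      = (\<Sum>\<alpha>\<in>{\<alpha> \<in> parking n S W. ?m \<le> \<alpha> i} \<union> {\<alpha> \<in> parking n S W. \<alpha> i < ?m}. ?t \<alpha>)"
    unfolding parking_enum_def by simp
  also have "\<dots> = (\<Sum>\<alpha>\<in>{\<alpha> \<in> parking n S W. ?m \<le> \<alpha> i}. ?t \<alpha>) + (\<Sum>\<alpha>\<in>{\<alpha> \<in> parking n S W. \<alpha> i < ?m}. ?t \<alpha>)"
    using finite_parking[OF finite_S] by (intro sum.union_disjoint) auto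
  also have "(\<Sum>\<alpha>\<in>{\<alpha> \<in> parking n S W. ?m \<le> \<alpha> i}. ?t \<alpha>) = parking_enum n w S (discard W u i)"
    unfolding parking_large_eq sum.reindex[OF inj_large] parking_enum_def
    by (simp add: parking_rsum_delete)
  also have "(\<Sum>\<alpha>\<in>{\<alpha> \<in> parking n S W. \<alpha> i < ?m}. ?t \<alpha>)
      = (\<Sum>(a, \<beta>)\<in>{..<?m} \<times> ?P. ?t (\<beta>(i := a)))"
    unfolding parking_small_eq sum.reindex[OF inj_small] by (simp add: case_prod_unfold)
  also have "\<dots> = (\<Sum>(a, \<beta>)\<in>{..<?m} \<times> ?P.
      q_var ^ ?c * (q_var ^ (?m - Suc a) * q_var ^ nat (parking_rsum n w (S - {i}) W \<beta>)))"
  proof (intro sum.cong refl, clarify)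
    fix a \<beta> assume a: "a < ?m" and \<beta>: "\<beta> \<in> ?P"
    have rsum: "parking_rsum n w S W (\<beta>(i := a))
        = int (?c + (?m - Suc a)) + parking_rsum n w (S - {i}) W \<beta>"
      by (rule parking_rsum_burn[OF sym]) (use a in auto)
    have "nat (parking_rsum n w S W (\<beta>(i := a)))
        = ?c + (?m - Suc a) + nat (parking_rsum n w (S - {i}) W \<beta>)"
      unfolding rsum using burn[OF \<beta>] by (simp only: nat_add_distrib of_nat_0_le_iff nat_int)
    then show "?t (\<beta>(i := a))
        = q_var ^ ?c * (q_var ^ (?m - Suc a) * q_var ^ nat (parking_rsum n w (S - {i}) W \<beta>))"
      by (simp only: power_add mult.assoc)
  qed
  also have "\<dots> = q_var ^ ?c * ((\<Sum>a<?m. q_var ^ (?m - Suc a)) * parking_enum n w (S - {i}) W)"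
    unfolding parking_enum_def sum_product sum.cartesian_product
    by (simp add: sum_distrib_left case_prod_unfold)
  also have "(\<Sum>a<?m. q_var ^ (?m - Suc a)) = q_int ?m"
    unfolding q_int_def by (rule sum.nat_diff_reindex)
  finally show ?thesis by (simp only: mult.assoc)
qed

end

section \<open>Trees relative to a burnt set\<close>

lemma q_int_0 [simp]: "q_int 0 = 0"
  by (simp add: q_int_def)

definition extensions :: "nat \<Rightarrow> nat set \<Rightarrow> (nat \<Rightarrow> nat) \<Rightarrow> (nat \<Rightarrow> nat) set" where
  "extensions n S p0 = {p \<in> parent_maps n. \<forall>x. x \<notin> S \<longrightarrow> p x = p0 x}"

text \<open>The part of \<open>\<kappa>\<close> that is due to the vertex \<open>j\<close> as the lower member of the pair.\<close>

definition inversion_weight ::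
  "nat \<Rightarrow> (nat \<Rightarrow> nat \<Rightarrow> nat) \<Rightarrow> (nat \<times> nat) set \<Rightarrow> (nat \<Rightarrow> nat) \<Rightarrow> nat \<Rightarrow> nat" where
  "inversion_weight n W r p j = (\<Sum>x | x \<in> {1..n} \<and> ancestor p x j \<and> (j, x) \<in> r. W (p x) j)"

text \<open>Only the unburnt vertices contribute; the factors of a burnt vertex are split off when it burns.\<close>

definition tree_term ::
  "nat \<Rightarrow> nat set \<Rightarrow> (nat \<Rightarrow> nat \<Rightarrow> nat) \<Rightarrow> (nat \<times> nat) set \<Rightarrow> (nat \<Rightarrow> nat) \<Rightarrow> int poly" where
  "tree_term n S W r p = (\<Prod>j\<in>S. q_int (W (p j) j) * q_var ^ inversion_weight n W r p j)"

definition tree_enum ::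
  "nat \<Rightarrow> nat set \<Rightarrow> (nat \<Rightarrow> nat \<Rightarrow> nat) \<Rightarrow> (nat \<times> nat) set \<Rightarrow> (nat \<Rightarrow> nat) \<Rightarrow> int poly" where
  "tree_enum n S W r p0 = (\<Sum>p\<in>extensions n S p0. tree_term n S W r p)"

text \<open>The map \<open>p0\<close> is the tree on the burnt vertices; its values on \<open>S\<close> are placeholders until the vertices
  burn. That no value lies in \<open>S\<close> makes the burnt set closed under taking parents and keeps \<open>p0\<close> a
  parent map when a vertex is attached. The last clause is the invariant of depth-first search: remaining edges into \<open>S\<close> start at \<open>u\<close>
  or at proper ancestors of \<open>u\<close>, and one from a proper ancestor \<open>v\<close> to \<open>j\<close> survives only if \<open>j\<close>
  precedes the child \<open>x\<close> of \<open>v\<close> on the way to \<open>u\<close>.\<close>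

definition burning_state ::
  "nat \<Rightarrow> (nat set \<Rightarrow> nat) \<Rightarrow> (nat \<times> nat) set \<Rightarrow> nat set \<Rightarrow> (nat \<Rightarrow> nat) \<Rightarrow> (nat \<Rightarrow> nat \<Rightarrow> nat) \<Rightarrow> nat \<Rightarrow> bool"
where
  "burning_state n w r S p0 W u \<longleftrightarrow>
     S \<subseteq> {1..n} \<and> p0 \<in> parent_maps n \<and> (\<forall>x. p0 x \<notin> S) \<and> u \<in> {0..n} - S \<and>
     (\<forall>j\<in>S. \<forall>k\<in>S. W j k = w {j, k}) \<and>
     (\<forall>j\<in>S. \<forall>v\<in>{0..n} - S. W v j \<noteq> 0 \<longrightarrow>
        v = u \<or> (\<exists>x\<in>{1..n}. ancestor p0 x u \<and> p0 x = v \<and> (j, x) \<in> r))"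

lemma finite_extensions: "finite (extensions n S p0)"
  by (rule finite_subset[OF _ finite_parent_maps]) (auto simp: extensions_def)

lemma extensions_burn:
  assumes "i \<in> S" "u \<notin> S"
  shows "{p \<in> extensions n S p0. p i = u} = extensions n (S - {i}) (p0(i := u))"
  using assms by (auto simp: extensions_def)

lemma attach_parent_map:
  assumes p0: "p0 \<in> parent_maps n" "\<And>x. p0 x \<notin> S" and i: "i \<in> S" "S \<subseteq> {1..n}" and u: "u \<in> {0..n} - S"
  shows "p0(i := u) \<in> parent_maps n"
proof -
  let ?p = "p0(i := u)"
  have "?p x = p0 x" if "x \<notin> S" for x using i that by auto
  then have anc_u: "ancestor ?p 0 u"
    using ancestor_agree(1)[of S ?p p0 u] p0(2) u root_ancestor[OF p0(1)] by blast
  have "ancestor ?p 0 x" for x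
  proof (induction x rule: parent_induct[OF p0(1)])
    case 1
    show ?case by simp
  next
    case (2 x)
    show ?case
    proof (cases "x = i")
      case True
      then show ?thesis using anc_u ancestor_unfold[of ?p 0 x] by (metis fun_upd_same)
    next
      case False
      then show ?thesis using 2 ancestor_unfold[of ?p 0 x] by (metis fun_upd_other)
    qed
  qed
  then show ?thesis using p0(1) i u unfolding parent_maps_def ancestor_def by auto
qed

lemma burning_state_pop:
  assumes state: "burning_state n w r S p0 W u" and dead: "\<And>j. j \<in> S \<Longrightarrow> W u j = 0"
  shows "burning_state n w r S p0 W (p0 u)"
proof -
  have "v = p0 u \<or> (\<exists>x\<in>{1..n}. ancestor p0 x (p0 u) \<and> p0 x = v \<and> (j, x) \<in> r)"
    if v: "j \<in> S" "v \<in> {0..n} - S" "W v j \<noteq> 0" for j v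
  proof -
    have "v \<noteq> u" using dead v by auto
    then obtain x where "x \<in> {1..n}" "ancestor p0 x u" "p0 x = v" "(j, x) \<in> r"
      using state v unfolding burning_state_def by blast
    then show ?thesis using ancestor_unfold[of p0 x u] by auto
  qed
  moreover have "p0 u \<in> {0..n} - S" using state by (auto simp: burning_state_def parent_maps_def)
  ultimately show ?thesis using state unfolding burning_state_def by blast
qed

lemma tree_term_root_dead:
  assumes "S \<noteq> {}" "finite S" "0 \<notin> S" "p \<in> parent_maps n"
    and dead: "\<And>v j. v \<in> {0..n} - S \<Longrightarrow> j \<in> S \<Longrightarrow> W v j = 0"
  shows "tree_term n S W r p = 0"
proof -
  obtain j where "j \<in> S" using assms(1) by blast
  then obtain y where "y \<in> S" "p y \<notin> S"
    using ancestor_exit[OF root_ancestor[OF assms(4), of j], of S] assms(3) by blast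
  moreover have "p y \<le> n" using assms(4) by (simp add: parent_maps_def)
  ultimately have "q_int (W (p y) y) * q_var ^ inversion_weight n W r p y = 0" using dead by simp
  then show ?thesis
    unfolding tree_term_def using \<open>y \<in> S\<close> assms(2) by (intro prod_zero) blast+
qed

text \<open>With no edge left into a nonempty \<open>S\<close>, the test set \<open>S\<close> itself excludes every parking function, and
  every tree has to enter \<open>S\<close> along an edge of weight \<open>0\<close>.\<close>

lemma burning_exhausted:
  assumes state: "burning_state n w r S p0 W 0" and dead: "\<And>j. j \<in> S \<Longrightarrow> W 0 j = 0"
  shows "(\<forall>\<alpha>\<in>parking n S W. 0 \<le> parking_rsum n w S W \<alpha>) \<and>
    parking_enum n w S W = tree_enum n S W r p0"
proof (cases "S = {}")
  case True
  have "parking n {} W = {\<lambda>_. undefined}" by (auto simp: parking_def)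
  moreover have "parking_rsum n w {} W \<alpha> = 0" for \<alpha>
  proof -
    have "nsets {} 2 = ({} :: nat set set)" by (auto simp: nsets_def)
    then show ?thesis by (simp add: parking_rsum_def)
  qed
  moreover have "extensions n {} p0 = {p0}"
    using state by (auto simp: extensions_def burning_state_def fun_eq_iff)
  ultimately show ?thesis using True by (simp add: parking_enum_def tree_enum_def tree_term_def)
next
  case False
  have p0: "p0 \<in> parent_maps n" and S: "S \<subseteq> {1..n}" using state by (auto simp: burning_state_def)
  have all_dead: "W v j = 0" if v: "v \<in> {0..n} - S" "j \<in> S" for v j
  proof (rule ccontr)
    assume "W v j \<noteq> 0"
    then obtain x where "x \<in> {1..n}" "ancestor p0 x 0"
      using state v dead unfolding burning_state_def by metis
    then show False using ancestor_root[OF p0] by fastforce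
  qed
  have "parking n S W = {}"
  proof -
    have "\<not> \<alpha> i < (\<Sum>v\<in>{0..n} - S. W v i)" if "i \<in> S" for \<alpha> i
      using all_dead that by simp
    then show ?thesis using False unfolding parking_def by blast
  qed
  moreover have "tree_enum n S W r p0 = 0"
    unfolding tree_enum_def
  proof (intro sum.neutral ballI tree_term_root_dead False)
    show "finite S" "0 \<notin> S" using S finite_subset by auto
  qed (use all_dead in \<open>auto simp: extensions_def\<close>)
  ultimately show ?thesis by (simp add: parking_enum_def)
qed

context
  fixes n :: nat and w :: "nat set \<Rightarrow> nat" and r :: "(nat \<times> nat) set" and S :: "nat set"
    and p0 :: "nat \<Rightarrow> nat" and W :: "nat \<Rightarrow> nat \<Rightarrow> nat" and u i :: nat
  assumes state: "burning_state n w r S p0 W u" and r: "trans r" "irrefl r"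
    and i: "i \<in> S" and max: "\<And>j. j \<in> S \<Longrightarrow> W u j \<noteq> 0 \<Longrightarrow> j = i \<or> (j, i) \<in> r"
begin

private lemma S: "S \<subseteq> {1..n}" and p0: "p0 \<in> parent_maps n" and p0_S: "p0 x \<notin> S"
  and u: "u \<in> {0..n} - S"
  using state by (auto simp: burning_state_def)

private lemma finite_unburnt: "finite S" using S finite_subset by blast

private lemma live:
  "j \<in> S \<Longrightarrow> v \<in> {0..n} - S \<Longrightarrow> W v j \<noteq> 0 \<Longrightarrow>
    v = u \<or> (\<exists>x\<in>{1..n}. ancestor p0 x u \<and> p0 x = v \<and> (j, x) \<in> r)"
  using state unfolding burning_state_def by blast

lemma burning_state_delete: "burning_state n w r S p0 (discard W u i) u"
proof -
  have "discard W u i v j \<noteq> 0 \<Longrightarrow> W v j \<noteq> 0" for v j by (auto split: if_splits)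
  moreover have "discard W u i j k = W j k" if "j \<in> S" for j k using that u by auto
  ultimately show ?thesis using state unfolding burning_state_def by metis
qed

lemma burning_state_burn:
  assumes "W u i \<noteq> 0"
  shows "burning_state n w r (S - {i}) (p0(i := u)) W i"
proof -
  let ?p = "p0(i := u)"
  have "v = i \<or> (\<exists>x\<in>{1..n}. ancestor ?p x i \<and> ?p x = v \<and> (j, x) \<in> r)"
    if v: "j \<in> S - {i}" "v \<in> {0..n} - (S - {i})" "W v j \<noteq> 0" for j v
  proof (cases "v = i")
    case False
    then have vS: "v \<in> {0..n} - S" using v by auto
    show ?thesis
    proof (cases "v = u")
      case True
      then have "(j, i) \<in> r" using max v by auto
      then show ?thesis using True i S by (intro disjI2 bexI[of _ i]) auto
    next
      case False
      then obtain x where x: "x \<in> {1..n}" "ancestor p0 x u" "p0 x = v" "(j, x) \<in> r"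
        using live[of j v] v vS by blast
      have "x \<notin> S" using ancestor_agree(2)[of S p0 p0 u x] p0_S u x by blast
      moreover have "ancestor ?p x u"
      proof -
        have "?p y = p0 y" if "y \<notin> S" for y using i that by auto
        then show ?thesis using ancestor_agree(1)[of S ?p p0 u x] p0_S u x by blast
      qed
      ultimately show ?thesis
        using x i ancestor_unfold[of ?p x i] by (intro disjI2 bexI[of _ x]) auto
    qed
  qed simp
  moreover have "?p \<in> parent_maps n" using attach_parent_map[OF p0 p0_S i S u] .
  moreover have "\<forall>x. ?p x \<notin> S - {i}" using p0_S u by auto
  moreover have "i \<in> {0..n} - (S - {i})" using i S by auto
  ultimately show ?thesis using state unfolding burning_state_def by blast
qed

text \<open>By the invariant, every remaining edge from \<open>i\<close> to a burnt vertex \<open>v \<noteq> u\<close> belongs to exactly one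
  inversion, namely the one formed by \<open>i\<close> and the child of \<open>v\<close> on the way to \<open>u\<close>.\<close>

lemma inversion_weight_burn:
  assumes p: "p \<in> extensions n S p0" "p i = u"
  shows "inversion_weight n W r p i = (\<Sum>v\<in>{0..n} - S - {u}. W v i)"
proof -
  have agree: "p x = p0 x" if "x \<notin> S" for x using p(1) that by (simp add: extensions_def)
  let ?I = "{x. x \<in> {1..n} \<and> ancestor p0 x u \<and> (i, x) \<in> r}"
  have notS: "x \<notin> S" if "x \<in> ?I" for x
    using ancestor_agree(2)[of S p0 p0 u x] p0_S u that by blast
  have "{x. x \<in> {1..n} \<and> ancestor p x i \<and> (i, x) \<in> r} = ?I"
  proof -
    have "ancestor p x i \<longleftrightarrow> ancestor p0 x u" if "(i, x) \<in> r" for x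
    proof -
      have "x \<noteq> i" using that r(2) by (auto simp: irrefl_def)
      then have "ancestor p x i \<longleftrightarrow> ancestor p x u" using ancestor_unfold[of p x i] p(2) by simp
      also have "\<dots> \<longleftrightarrow> ancestor p0 x u"
        using ancestor_agree(1)[of S p p0 u x] agree p0_S u by blast
      finally show ?thesis .
    qed
    then show ?thesis by blast
  qed
  then have "inversion_weight n W r p i = (\<Sum>x\<in>?I. W (p0 x) i)"
    unfolding inversion_weight_def using agree notS by (intro sum.cong) auto
  also have "\<dots> = (\<Sum>v\<in>p0 ` ?I. W v i)"
  proof -
    have "inj_on p0 ?I" by (rule inj_on_subset[OF parent_inj_on_ancestors[OF p0, of u]]) auto
    then show ?thesis by (simp add: sum.reindex)
  qed
  also have "\<dots> = (\<Sum>v\<in>{0..n} - S - {u}. W v i)"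
  proof (rule sum.mono_neutral_left)
    show "p0 ` ?I \<subseteq> {0..n} - S - {u}"
    proof
      fix v assume "v \<in> p0 ` ?I"
      then obtain x where x: "x \<in> ?I" "v = p0 x" by blast
      then have "v \<noteq> u" using parent_not_descendant[OF p0, of x] by auto
      moreover have "v \<le> n" using p0 x by (simp add: parent_maps_def)
      ultimately show "v \<in> {0..n} - S - {u}" using p0_S x by simp
    qed
    show "\<forall>v\<in>{0..n} - S - {u} - p0 ` ?I. W v i = 0" using live[OF i] by blast
  qed simp
  finally show ?thesis .
qed

text \<open>The edges between \<open>u\<close> and \<open>i\<close> could be counted only through a child \<open>x\<close> of \<open>u\<close> above \<open>i\<close> with
  \<open>i \<prec> x\<close>. If \<open>x\<close> is unburnt, this contradicts the maximality of \<open>i\<close>. If \<open>x\<close> is burnt, the tree enters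
  \<open>S\<close> along an edge of positive weight at \<open>x\<close> or below \<open>x\<close>; but such edges start only at \<open>u\<close> and
  its ancestors.\<close>

lemma inversion_weight_delete:
  assumes p: "p \<in> extensions n S p0" and nz: "\<And>j. j \<in> S \<Longrightarrow> W (p j) j \<noteq> 0"
  shows "inversion_weight n (discard W u i) r p j = inversion_weight n W r p j"
proof -
  have agree: "p x = p0 x" if "x \<notin> S" for x using p(1) that by (simp add: extensions_def)
  have "p x \<noteq> u" if x: "x \<in> {1..n}" "ancestor p x i" "(i, x) \<in> r" for x
  proof
    assume pu: "p x = u"
    show False
    proof (cases "x \<in> S")
      case True
      then have "x = i \<or> (x, i) \<in> r" using max nz[of x] pu by auto
      then show False using r x(3) by (auto simp: irrefl_def dest: transD)
    next
      case False
      then obtain y where y: "y \<in> S" "p y \<notin> S" "ancestor p x (p y)"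
        using ancestor_exit[OF x(2) i] by blast
      have "p y \<le> n" using p by (simp add: extensions_def parent_maps_def)
      then have "p y = u \<or> (\<exists>x\<in>{1..n}. ancestor p0 x u \<and> p0 x = p y \<and> (y, x) \<in> r)"
        using live[OF y(1), of "p y"] y nz by auto
      then have "ancestor p0 (p y) u"
        by (metis ancestor_refl ancestor_trans ancestor_parent)
      moreover have "ancestor p0 x (p y)"
        using ancestor_agree(1)[of S p p0 "p y" x] agree p0_S y by blast
      ultimately have "ancestor p0 x (p0 x)"
        using ancestor_trans pu agree[OF False] by metis
      then show False using parent_not_descendant[OF p0, of x] x by auto
    qed
  qed
  then show ?thesis unfolding inversion_weight_def by (intro sum.cong) auto
qed

text \<open>A tree that uses the discarded edge drops out because \<open>[0]\<^sub>q = 0\<close>. A tree that uses another edge of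
  weight \<open>0\<close> has term \<open>0\<close> before and after.\<close>

lemma tree_term_delete:
  assumes p: "p \<in> extensions n S p0"
  shows "tree_term n S (discard W u i) r p = (if p i = u then 0 else tree_term n S W r p)"
proof (cases "\<exists>j\<in>S. discard W u i (p j) j = 0")
  case True
  have zero: "tree_term n S X r p = 0" if "\<exists>j\<in>S. X (p j) j = 0" for X
  proof -
    from that obtain j where "j \<in> S" "X (p j) j = 0" by blast
    then show ?thesis unfolding tree_term_def using finite_unburnt by (intro prod_zero bexI[of _ j]) auto
  qed
  have "p i = u \<or> (\<exists>j\<in>S. W (p j) j = 0)" using True by (auto split: if_splits)
  then show ?thesis using zero[of "discard W u i"] zero[of W] True by auto
next
  case False
  then have pi: "p i \<noteq> u" using i by auto
  have eq: "discard W u i (p j) j = W (p j) j" for j using pi by auto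
  then have nz: "W (p j) j \<noteq> 0" if "j \<in> S" for j using False that by metis
  have "inversion_weight n (discard W u i) r p j = inversion_weight n W r p j" for j
    using nz by (rule inversion_weight_delete[OF p])
  then have "tree_term n S (discard W u i) r p = tree_term n S W r p"
    unfolding tree_term_def eq by simp
  then show ?thesis using pi by simp
qed

lemma tree_term_burn:
  assumes "p \<in> extensions n S p0" "p i = u"
  shows "tree_term n S W r p
    = q_var ^ (\<Sum>v\<in>{0..n} - S - {u}. W v i) * q_int (W u i) * tree_term n (S - {i}) W r p"
  unfolding tree_term_def prod.remove[OF finite_unburnt i] inversion_weight_burn[OF assms] assms(2)
  by (simp only: mult.commute)

lemma tree_enum_step:
  "tree_enum n S W r p0 = tree_enum n S (discard W u i) r p0
    + q_var ^ (\<Sum>v\<in>{0..n} - S - {u}. W v i) * q_int (W u i) * tree_enum n (S - {i}) W r (p0(i := u))"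
proof -
  let ?X = "extensions n S p0" and ?t = "tree_term n S W r"
  have "tree_enum n S W r p0 = (\<Sum>p\<in>?X. (if p i = u then 0 else ?t p) + (if p i = u then ?t p else 0))"
    unfolding tree_enum_def by (intro sum.cong) auto
  also have "\<dots> = tree_enum n S (discard W u i) r p0 + (\<Sum>p\<in>{p \<in> ?X. p i = u}. ?t p)"
    unfolding sum.distrib tree_enum_def
    using tree_term_delete finite_extensions by (simp add: sum.inter_filter)
  also have "(\<Sum>p\<in>{p \<in> ?X. p i = u}. ?t p) = (\<Sum>p\<in>{p \<in> ?X. p i = u}.
      q_var ^ (\<Sum>v\<in>{0..n} - S - {u}. W v i) * q_int (W u i) * tree_term n (S - {i}) W r p)"
    using tree_term_burn by (intro sum.cong) auto
  also have "\<dots> = q_var ^ (\<Sum>v\<in>{0..n} - S - {u}. W v i) * q_int (W u i)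
      * tree_enum n (S - {i}) W r (p0(i := u))"
    unfolding tree_enum_def sum_distrib_left
    using extensions_burn[of i S u n p0] i u by simp
  finally show ?thesis .
qed

end

section \<open>Depth-first burning\<close>

lemma finite_total_max:
  assumes "finite M" "M \<noteq> {}" "M \<subseteq> A" "trans r" "total_on A r"
  shows "\<exists>i\<in>M. \<forall>j\<in>M. j = i \<or> (j, i) \<in> r"
  using assms(1-3)
proof (induction M rule: finite_ne_induct)
  case (insert x F)
  then obtain i where i: "i \<in> F" "\<forall>j\<in>F. j = i \<or> (j, i) \<in> r" by auto
  have "(x, i) \<in> r \<or> (i, x) \<in> r" using insert i assms(5) unfolding total_on_def by (metis insertCI subsetD)
  then show ?case
  proof
    assume "(x, i) \<in> r"
    then show ?thesis using i by auto
  next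
    assume ix: "(i, x) \<in> r"
    then have "\<forall>j\<in>insert x F. j = x \<or> (j, x) \<in> r" using i(2) assms(4) by (auto dest: transD)
    then show ?thesis by blast
  qed
qed simp

text \<open>The induction is lexicographic: burning \<open>i\<close> shrinks \<open>S\<close>, discarding edges keeps \<open>S\<close> and shrinks the
  set of pairs with positive capacity, and backtracking keeps both and decreases the depth of \<open>u\<close>.\<close>

lemma parking_enum_eq_tree_enum:
  assumes r: "trans r" "irrefl r" "total_on {1..n} r"
  shows "burning_state n w r S p0 W u \<Longrightarrow>
    (\<forall>\<alpha>\<in>parking n S W. 0 \<le> parking_rsum n w S W \<alpha>) \<and>
    parking_enum n w S W = tree_enum n S W r p0"
proof -
  define live where "live W = {vj \<in> {0..n} \<times> {0..n}. W (fst vj) (snd vj) \<noteq> 0}"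
    for W :: "nat \<Rightarrow> nat \<Rightarrow> nat"
  define R where "R = measures [\<lambda>(S :: nat set, p0 :: nat \<Rightarrow> nat, W, u :: nat). card S,
    \<lambda>(S, p0, W, u). card (live W), \<lambda>(S, p0, W, u). depth p0 u]"
  have "wf R" unfolding R_def by (rule wf_measures)
  then show "burning_state n w r S p0 W u \<Longrightarrow> ?thesis"
  proof (induction "(S, p0, W, u)" arbitrary: S p0 W u rule: wf_induct_rule)
    case less
    note state = less.prems
    have S: "S \<subseteq> {1..n}" and p0: "p0 \<in> parent_maps n" and u: "u \<in> {0..n} - S"
      and inner: "\<And>j k. j \<in> S \<Longrightarrow> k \<in> S \<Longrightarrow> W j k = w {j, k}"
      using state unfolding burning_state_def by blast+
    have fin: "finite S" using S finite_subset by blast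
    show ?case
    proof (cases "\<exists>j\<in>S. W u j \<noteq> 0")
      case False
      then have dead: "W u j = 0" if "j \<in> S" for j using that by blast
      show ?thesis
      proof (cases "u = 0")
        case True
        then show ?thesis using burning_exhausted[of n w r S p0 W] state dead by simp
      next
        case False
        have "((S, p0, W, p0 u), (S, p0, W, u)) \<in> R"
          using depth_parent[OF p0 False] by (simp add: R_def)
        then show ?thesis using less.hyps burning_state_pop[OF state dead] by blast
      qed
    next
      case True
      let ?M = "{j \<in> S. W u j \<noteq> 0}"
      have "\<exists>i\<in>?M. \<forall>j\<in>?M. j = i \<or> (j, i) \<in> r"
        by (rule finite_total_max[OF _ _ _ r(1) r(3)]) (use True fin S in auto)
      then obtain i where i: "i \<in> S" "W u i \<noteq> 0"
        and max: "\<And>j. j \<in> S \<Longrightarrow> W u j \<noteq> 0 \<Longrightarrow> j = i \<or> (j, i) \<in> r" by blast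
      let ?W' = "discard W u i"
      have "live ?W' \<subset> live W"
      proof
        show "live ?W' \<subseteq> live W" by (auto simp: live_def split: if_splits)
        have "(u, i) \<in> live W" "(u, i) \<notin> live ?W'" using i S u by (auto simp: live_def)
        then show "live ?W' \<noteq> live W" by blast
      qed
      then have "card (live ?W') < card (live W)" by (intro psubset_card_mono) (auto simp: live_def)
      then have del: "((S, p0, ?W', u), (S, p0, W, u)) \<in> R" by (simp add: R_def)
      have "card (S - {i}) < card S" using fin i(1) by (rule card_Diff1_less)
      then have burn: "((S - {i}, p0(i := u), W, i), (S, p0, W, u)) \<in> R" by (simp add: R_def)
      note IH_del = less.hyps[OF del burning_state_delete[OF state r(1,2) i(1) max]]
      note IH_burn = less.hyps[OF burn burning_state_burn[OF state r(1,2) i(1) max i(2)]]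
      have S0: "S \<subseteq> {0..n}" using S by auto
      have sym: "W i j = w {i, j}" if "j \<in> S - {i}" for j using inner i(1) that by blast
      have nonneg: "0 \<le> parking_rsum n w S W \<alpha>" if "\<alpha> \<in> parking n S W" for \<alpha>
        by (rule parking_rsum_nonneg_step[OF S0 i(1) u _ _ _ that]) (use sym IH_del IH_burn in blast)+
      have "parking_enum n w S W = parking_enum n w S ?W'
          + q_var ^ (\<Sum>v\<in>{0..n} - S - {u}. W v i) * q_int (W u i) * parking_enum n w (S - {i}) W"
        by (rule parking_enum_step[OF S0 i(1) u]) (use sym IH_burn in blast)+
      also have "\<dots> = tree_enum n S ?W' r p0
          + q_var ^ (\<Sum>v\<in>{0..n} - S - {u}. W v i) * q_int (W u i) * tree_enum n (S - {i}) W r (p0(i := u))"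
        using IH_del IH_burn by simp
      also have "\<dots> = tree_enum n S W r p0"
        by (rule tree_enum_step[OF state r(1,2) i(1), symmetric]) (rule max)
      finally show ?thesis using nonneg by blast
    qed
  qed
qed

section \<open>Specialization to the whole graph\<close>

lemma kappa_parent_edges:
  assumes p: "p \<in> parent_maps n"
  shows "kappa n w (parent_edges n p) r = (\<Sum>j\<in>{1..n}. inversion_weight n (\<lambda>v j. w {v, j}) r p j)"
proof -
  let ?I = "\<lambda>j. {x. x \<in> {1..n} \<and> ancestor p x j \<and> (j, x) \<in> r}"
  have "kappa n w (parent_edges n p) r = (\<Sum>(j, x)\<in>Sigma {1..n} ?I. w {p x, j})"
    unfolding kappa_def
    by (rule sum.reindex_bij_witness[of _ prod.swap prod.swap])
      (auto simp: root_path_parent_edges[OF p])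
  also have "\<dots> = (\<Sum>j\<in>{1..n}. \<Sum>x\<in>?I j. w {p x, j})"
    by (rule sum.Sigma[symmetric]) auto
  finally show ?thesis by (simp add: inversion_weight_def)
qed

lemma tree_term_parent_edges:
  assumes p: "p \<in> parent_maps n"
  shows "tree_term n {1..n} (\<lambda>v j. w {v, j}) r p
    = q_var ^ kappa n w (parent_edges n p) r * (\<Prod>e\<in>parent_edges n p. q_int (w e))"
proof -
  have "(\<Prod>e\<in>parent_edges n p. q_int (w e)) = (\<Prod>j\<in>{1..n}. q_int (w {p j, j}))"
    unfolding parent_edges_def prod.reindex[OF inj_on_parent_edge[OF p]] by (simp add: insert_commute)
  then show ?thesis
    by (simp add: tree_term_def prod.distrib kappa_parent_edges[OF p] power_sum mult.commute)
qed

text \<open>Parent maps that use a pair of multiplicity \<open>0\<close> are not spanning trees of the graph, but their terms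
  vanish.\<close>

lemma tree_enum_SPT:
  "tree_enum n {1..n} (\<lambda>v j. w {v, j}) r (\<lambda>_. 0)
    = (\<Sum>T\<in>SPT n w. q_var ^ kappa n w T r * (\<Prod>e\<in>T. q_int (w e)))"
proof -
  let ?t = "tree_term n {1..n} (\<lambda>v j. w {v, j}) r"
  let ?good = "{p \<in> parent_maps n. \<forall>x\<in>{1..n}. w {p x, x} \<noteq> 0}"
  have "extensions n {1..n} (\<lambda>_. 0) = parent_maps n"
    by (auto simp: extensions_def parent_maps_def)
  then have "tree_enum n {1..n} (\<lambda>v j. w {v, j}) r (\<lambda>_. 0) = (\<Sum>p\<in>parent_maps n. ?t p)"
    by (simp add: tree_enum_def)
  also have "\<dots> = (\<Sum>p\<in>?good. ?t p)"
  proof (rule sum.mono_neutral_right)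
    show "\<forall>p\<in>parent_maps n - ?good. ?t p = 0"
    proof
      fix p assume "p \<in> parent_maps n - ?good"
      then obtain x where "x \<in> {1..n}" "w {p x, x} = 0" by blast
      then show "?t p = 0" unfolding tree_term_def by (intro prod_zero) (auto intro: bexI[of _ x])
    qed
  qed (auto simp: finite_parent_maps)
  also have "\<dots> = (\<Sum>p\<in>?good. q_var ^ kappa n w (parent_edges n p) r * (\<Prod>e\<in>parent_edges n p. q_int (w e)))"
    by (intro sum.cong refl tree_term_parent_edges) simp
  also have "\<dots> = (\<Sum>T\<in>SPT n w. q_var ^ kappa n w T r * (\<Prod>e\<in>T. q_int (w e)))"
    by (rule sum.reindex_bij_betw[OF bij_betw_parent_edges])
  finally show ?thesis .
qed

lemma parking_enum_PF:
  "parking_enum n w {1..n} (\<lambda>v j. w {v, j}) = (\<Sum>\<alpha>\<in>PF n w. q_var ^ nat (rsum n w \<alpha>))"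
proof -
  have "int a \<le> int b - 1 \<longleftrightarrow> a < b" for a b by auto
  then have "parking n {1..n} (\<lambda>v j. w {v, j}) = PF n w"
    unfolding parking_def PF_def by (simp only: insert_commute)
  moreover have "parking_rsum n w {1..n} (\<lambda>v j. w {v, j}) \<alpha> = rsum n w \<alpha>" for \<alpha>
  proof -
    have "{0..n} = insert 0 {1..n}" by auto
    then have "num_edges n w = (\<Sum>e\<in>nsets {1..n} 2. w e) + (\<Sum>j\<in>{1..n}. w {0, j})"
      unfolding num_edges_def using sum_nsets2_insert[of "{1..n}" 0 w] by simp
    moreover have "{0..n} - {1..n} = {0}" by auto
    ultimately show ?thesis by (simp add: parking_rsum_def rsum_def)
  qed
  ultimately show ?thesis by (simp add: parking_enum_def)
qed

theorem theorem3p1: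
  fixes n :: nat and w :: "nat set \<Rightarrow> nat" and r :: "(nat \<times> nat) set"
  assumes "n \<ge> 1"
    and "multigraph_connected n w"
    and "r \<subseteq> {1..n} \<times> {1..n}"
    and "strict_linear_order_on {1..n} r"
  shows "(\<Sum>\<alpha>\<in>PF n w. q_var ^ nat (rsum n w \<alpha>))
       = (\<Sum>T\<in>SPT n w. q_var ^ kappa n w T r * (\<Prod>e\<in>T. q_int (w e)))"
proof -
  have "(\<lambda>_. 0) \<in> parent_maps n" by (auto simp: parent_maps_def intro: exI[of _ 1])
  then have "burning_state n w r {1..n} (\<lambda>_. 0) (\<lambda>v j. w {v, j}) 0"
    by (auto simp: burning_state_def)
  then have "parking_enum n w {1..n} (\<lambda>v j. w {v, j}) = tree_enum n {1..n} (\<lambda>v j. w {v, j}) r (\<lambda>_. 0)"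
    using parking_enum_eq_tree_enum assms(4) unfolding strict_linear_order_on_def by blast
  then show ?thesis unfolding parking_enum_PF tree_enum_SPT .
qed

end
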